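(* Let $n\geqslant 4$ and let $M_n$ be the set of all strictly convex closed polyhedra in $\mathbb{R}^3$ with $n$ faces, endowed with the Hausdorff metric. There exists an open dense subset $\Omega_n\subset M_n$ such that for any $P,P'\in\Omega_n$ the following conditions are equivalent: (i) $P$ and $P'$ are combinatorially equivalent and every two corresponding faces are affine-equivalent; (ii) $P$ and $P'$ are affine-equivalent.
   Context: A closed convex polyhedron is strictly convex if none of its dihedral angles equals $\pi$. Two polyhedra are combinatorially equivalent if there is an incidence-preserving bijection between their vertices, edges and faces. Two corresponding polygons (resp. combinatorially equivalent polyhedra) are affine-equivalent if there is a nondegenerate affine map of the plane/space carrying the first onto the second and each vertex, edge (and face) to the corresponding one. *)

theory Defs
  imports "HOL-Analysis.Analysis"
begin

type_synonym pt = "real^3"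

definition hausdorff_dist :: "pt set \<Rightarrow> pt set \<Rightarrow> real" where
  "hausdorff_dist S T =
     max (SUP x\<in>S. infdist x T) (SUP y\<in>T. infdist y S)"

definition vertices :: "pt set \<Rightarrow> pt set set" where
  "vertices P = {V. V face_of P \<and> aff_dim V = 0}"

definition edges :: "pt set \<Rightarrow> pt set set" where
  "edges P = {E. E edge_of P}"

definition faces2 :: "pt set \<Rightarrow> pt set set" where
  "faces2 P = {F. F facet_of P}"

text \<open>Strictly convex closed polyhedron in R^3: a 3-dimensional convex polytope
  (bounded, closed, convex hull of finitely many points).  Its faces are its
  facets, i.e. maximal planar pieces of the boundary, so no dihedral angle is pi.\<close>
definition strictly_convex_polyhedron :: "pt set \<Rightarrow> bool" where
  "strictly_convex_polyhedron P \<longleftrightarrow> polytope P \<and> aff_dim P = 3"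

definition M :: "nat \<Rightarrow> pt set set" where
  "M n = {P. strictly_convex_polyhedron P \<and> card (faces2 P) = n}"

definition nondeg_affine :: "(pt \<Rightarrow> pt) \<Rightarrow> bool" where
  "nondeg_affine A \<longleftrightarrow> (\<exists>L c. invertible L \<and> (\<forall>x. A x = L *v x + c))"

definition comb_equiv ::
  "pt set \<Rightarrow> pt set \<Rightarrow> (pt set \<Rightarrow> pt set) \<Rightarrow> (pt set \<Rightarrow> pt set) \<Rightarrow> (pt set \<Rightarrow> pt set) \<Rightarrow> bool" where
  "comb_equiv P P' fv fe ff \<longleftrightarrow>
     bij_betw fv (vertices P) (vertices P') \<and>
     bij_betw fe (edges P) (edges P') \<and>
     bij_betw ff (faces2 P) (faces2 P') \<and>
     (\<forall>v\<in>vertices P. \<forall>e\<in>edges P. v \<subseteq> e \<longleftrightarrow> fv v \<subseteq> fe e) \<and>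
     (\<forall>v\<in>vertices P. \<forall>F\<in>faces2 P. v \<subseteq> F \<longleftrightarrow> fv v \<subseteq> ff F) \<and>
     (\<forall>e\<in>edges P. \<forall>F\<in>faces2 P. e \<subseteq> F \<longleftrightarrow> fe e \<subseteq> ff F)"

definition combinatorially_equivalent :: "pt set \<Rightarrow> pt set \<Rightarrow> bool" where
  "combinatorially_equivalent P P' \<longleftrightarrow> (\<exists>fv fe ff. comb_equiv P P' fv fe ff)"

text \<open>Condition (i): combinatorially equivalent such that every two corresponding
  faces are affine-equivalent (an affine isomorphism of the planes of the faces,
  realised as the restriction of a nondegenerate affine map of space, carrying the
  face onto the corresponding face and each of its vertices and edges onto the
  corresponding ones).\<close>
definition faces_affine_equivalent :: "pt set \<Rightarrow> pt set \<Rightarrow> bool" where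
  "faces_affine_equivalent P P' \<longleftrightarrow>
     (\<exists>fv fe ff. comb_equiv P P' fv fe ff \<and>
        (\<forall>F\<in>faces2 P. \<exists>A. nondeg_affine A \<and> A ` F = ff F \<and>
            (\<forall>v\<in>vertices P. v \<subseteq> F \<longrightarrow> A ` v = fv v) \<and>
            (\<forall>e\<in>edges P. e \<subseteq> F \<longrightarrow> A ` e = fe e)))"

definition affine_equivalent :: "pt set \<Rightarrow> pt set \<Rightarrow> bool" where
  "affine_equivalent P P' \<longleftrightarrow> (\<exists>A. nondeg_affine A \<and> A ` P = P')"

definition open_in_M :: "pt set set \<Rightarrow> pt set set \<Rightarrow> bool" where
  "open_in_M X \<Omega> \<longleftrightarrow> \<Omega> \<subseteq> X \<and>
     (\<forall>P\<in>\<Omega>. \<exists>\<epsilon>>0. \<forall>Q\<in>X. hausdorff_dist P Q < \<epsilon> \<longrightarrow> Q \<in> \<Omega>)"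

definition dense_in_M :: "pt set set \<Rightarrow> pt set set \<Rightarrow> bool" where
  "dense_in_M X \<Omega> \<longleftrightarrow> (\<forall>P\<in>X. \<forall>\<epsilon>>0. \<exists>Q\<in>\<Omega>. hausdorff_dist P Q < \<epsilon>)"

end

theory Submission
  imports Defs
begin

text \<open>
  The set \<open>\<Omega>\<close> consists of the simple polyhedra: at most three facets pass through any point.
  At a simple vertex, the affine maps of the three facets agree along the three edges, hence extend
  to one affine map of space. Two adjacent vertices share two facets, whose planes span space, so
  their maps coincide; as the edge graph is connected, all vertices share one affine map.
  Openness holds because the facet planes of polyhedra with a fixed number of facets depend
  continuously on the polyhedron; density follows by moving the \<open>i\<close>-th facet plane outwards by
  \<open>s\<close> to the power \<open>i + 1\<close> for small generic \<open>s\<close>.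
\<close>

section \<open>Simple polytopes\<close>

text \<open>Three independent edge vectors at a vertex can be sent anywhere by one linear map. With
  four or more facets the edge vectors are dependent, and face maps that agree along edges need not
  fit together; hence the condition on the number of facets through a point. The map of the whole
  polyhedron is built at one vertex and compared with the face maps at vertices only: all that the
  argument takes from the face maps is a map \<open>\<phi>\<close> of extreme points that is affine
  on the vertices of each facet. Its affine extension is proved invertible only at the end, because
  \<open>P'\<close> spans space. Openness depends on the fixed number of facets: arbitrarily near a
  simple polyhedron there are non-simple ones with more facets, the extra ones degenerating in the
  limit. For density, moving planes outwards gives \<open>P \<subseteq> Q\<close>, so full dimension
  and half of the Hausdorff estimate are immediate; distinct powers of a single parameter replace
  independent shifts, so only finitely many values must be avoided.\<close>

lemma polyhedron_facet_halfspaces: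
  fixes P :: "'a::euclidean_space set"
  assumes P: "polyhedron P" and full: "affine hull P = UNIV"
  obtains a b where
    "\<And>F. F facet_of P \<Longrightarrow> norm (a F) = 1"
    "\<And>F. F facet_of P \<Longrightarrow> F = P \<inter> {x. a F \<bullet> x = b F}"
    "P = {x. \<forall>F. F facet_of P \<longrightarrow> a F \<bullet> x \<le> b F}"
proof -
  have "\<exists>a b. norm a = 1 \<and> P \<subseteq> {x. a \<bullet> x \<le> b} \<and> F = P \<inter> {x. a \<bullet> x = b}" if F: "F facet_of P" for F
  proof -
    obtain a b where ab: "a \<noteq> 0" "P \<subseteq> {x. a \<bullet> x \<le> b}" "F = P \<inter> {x. a \<bullet> x = b}"
      using facet_of_polyhedron[OF P F] by blast
    \<comment> \<open>Unit normals form a bounded family, as compactness will require, and a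
      displacement along one changes its offset by the same amount.\<close>
    have "norm (a /\<^sub>R norm a) = 1"
      using ab by simp
    moreover have "P \<subseteq> {x. (a /\<^sub>R norm a) \<bullet> x \<le> b / norm a}"
      using ab by (auto simp: field_simps)
    moreover have "F = P \<inter> {x. (a /\<^sub>R norm a) \<bullet> x = b / norm a}"
      using ab by (auto simp: field_simps)
    ultimately show ?thesis by blast
  qed
  then obtain a b where ab: "\<And>F. F facet_of P \<Longrightarrow> norm (a F) = 1"
      "\<And>F. F facet_of P \<Longrightarrow> P \<subseteq> {x. a F \<bullet> x \<le> b F}"
      "\<And>F. F facet_of P \<Longrightarrow> F = P \<inter> {x. a F \<bullet> x = b F}"
    by metis
  \<comment> \<open>On the way from an interior point \<open>p\<close> to an outside point
    \<open>x\<close>, the frontier is met at some \<open>y\<close> on a facet \<open>F\<close>. The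
    inequality of \<open>F\<close> is strict at \<open>p\<close> and tight at \<open>y\<close>, so
    it fails at \<open>x\<close>.\<close>
  have "x \<in> P" if x: "\<And>F. F facet_of P \<Longrightarrow> a F \<bullet> x \<le> b F" for x
  proof (rule ccontr)
    assume "x \<notin> P"
    have "interior P \<noteq> {}"
      using rel_interior_eq_empty[OF polyhedron_imp_convex[OF P]] full rel_interior_interior[OF full]
      by force
    then obtain p where p: "p \<in> interior P" by blast
    have "closed_segment p x \<inter> frontier P \<noteq> {}"
      using \<open>x \<notin> P\<close> p interior_subset by (intro connected_Int_frontier) fastforce+
    then obtain y where y: "y \<in> closed_segment p x" "y \<in> frontier P" by blast
    have "frontier P = rel_frontier P"
      using full by (simp add: frontier_def rel_frontier_def rel_interior_interior)
    then obtain F where F: "F facet_of P" "y \<in> F"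
      using y rel_frontier_of_polyhedron[OF P] by blast
    have "p \<notin> F"
      using face_of_disjoint_interior[of F P] F p facet_of_imp_face_of[OF F(1)] facet_of_irrefl[of P] by blast
    then have 1: "a F \<bullet> p < b F"
      using ab(2,3)[OF F(1)] p interior_subset by force
    obtain t where t: "0 \<le> t" "t \<le> 1" "y = (1-t) *\<^sub>R p + t *\<^sub>R x"
      using y by (auto simp: in_segment)
    have "y \<in> P" using F facet_of_imp_subset by blast
    then have "t \<noteq> 1" using t \<open>x \<notin> P\<close> by auto
    then have "(1-t) * (a F \<bullet> p) < (1-t) * b F"
      using 1 t by simp
    moreover have "t * (a F \<bullet> x) \<le> t * b F"
      using x[OF F(1)] t by (simp add: mult_left_mono)
    moreover have "a F \<bullet> y = b F" using ab(3)[OF F(1)] F by blast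
    ultimately show False using t by (simp add: inner_simps algebra_simps)
  qed
  then have "P = {x. \<forall>F. F facet_of P \<longrightarrow> a F \<bullet> x \<le> b F}"
    using ab(2) by blast
  then show thesis using that ab by blast
qed

text \<open>A relative interior point of \<open>F\<close> makes some inequality tight, since
  finitely many strict ones would make it interior to \<open>P\<close>. The face cut out by that
  inequality then contains \<open>F\<close>, and is proper, so dimension forces equality. Redundant
  halfspaces are allowed.\<close>

lemma facet_of_halfspaces:
  fixes P :: "'a::euclidean_space set"
  assumes I: "finite I" and P: "P = {x. \<forall>i\<in>I. a i \<bullet> x \<le> b i}"
    and nz: "\<And>i. i \<in> I \<Longrightarrow> a i \<noteq> 0"
    and full: "affine hull P = UNIV" and F: "F facet_of P"
  shows "\<exists>i\<in>I. F = P \<inter> {x. a i \<bullet> x = b i}"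
proof -
  have cP: "convex P"
    unfolding P by (auto simp: convex_alt inner_simps intro!: convex_bound_le)
  have Fface: "F face_of P" and Fne: "F \<noteq> {}" and Fdim: "aff_dim F = aff_dim P - 1"
    using F by (auto simp: facet_of_def)
  have "rel_interior F \<noteq> {}"
    using Fne face_of_imp_convex[OF Fface] rel_interior_eq_empty by blast
  then obtain x where x: "x \<in> rel_interior F" by blast
  then have xF: "x \<in> F" using rel_interior_subset by blast
  then have xP: "x \<in> P" using Fface face_of_imp_subset by blast
  have "\<exists>i\<in>I. a i \<bullet> x = b i"
  proof (rule ccontr)
    assume "\<not> ?thesis"
    then have "x \<in> (\<Inter>i\<in>I. {x. a i \<bullet> x < b i})" using xP P by force
    moreover have "open (\<Inter>i\<in>I. {x. a i \<bullet> x < b i})"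
      using I by (intro open_INT) (auto simp: open_halfspace_lt)
    moreover have "(\<Inter>i\<in>I. {x. a i \<bullet> x < b i}) \<subseteq> P"
      unfolding P by force
    ultimately have "x \<in> interior P" by (metis interiorI)
    then show False
      using face_of_disjoint_interior[OF Fface] xF F facet_of_irrefl by blast
  qed
  then obtain i where i: "i \<in> I" "a i \<bullet> x = b i" by blast
  define G where "G = P \<inter> {x. a i \<bullet> x = b i}"
  have G: "G face_of P"
    unfolding G_def by (rule face_of_Int_supporting_hyperplane_le[OF cP]) (use P i in auto)
  have "G \<noteq> P"
  proof
    assume "G = P"
    then have "affine hull P \<subseteq> {x. a i \<bullet> x = b i}"
      unfolding G_def by (intro hull_minimal) (auto simp: affine_hyperplane)
    then have "\<And>x. a i \<bullet> x = b i" using full by blast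
    from this[of 0] this[of "a i"] nz[OF i(1)] show False by simp
  qed
  then have "aff_dim G < aff_dim P"
    using face_of_aff_dim_lt[OF cP G] by blast
  moreover have FG: "F \<subseteq> G"
    using x xF xP i by (intro subset_of_face_of[OF G face_of_imp_subset[OF Fface]]) (auto simp: G_def)
  moreover have "F face_of G"
    by (rule face_of_subset[OF Fface FG face_of_imp_subset[OF G]])
  ultimately have "F = G"
    using face_of_aff_dim_lt[of G F] face_of_imp_convex[OF G] Fdim by force
  then show ?thesis using i G_def by blast
qed

text \<open>An upper bound at every point, rather than equality at vertices, is the form that passes
  to limits and can be enforced by perturbation; equality at vertices follows in
  \<open>card_facets_at_vertex\<close>.\<close>

definition simple_polytope :: "'a::euclidean_space set \<Rightarrow> bool" where
  "simple_polytope P \<longleftrightarrow> polytope P \<and> affine hull P = UNIV \<and>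
     (\<forall>x. card {F. F facet_of P \<and> x \<in> F} \<le> DIM('a))"

section \<open>Facet normals and edges at a vertex of a simple polytope\<close>

locale simple_polytope_halfspaces =
  fixes P :: "'a::euclidean_space set" and a :: "'a set \<Rightarrow> 'a" and b :: "'a set \<Rightarrow> real"
  assumes simple: "simple_polytope P"
    and facet: "\<And>F. F facet_of P \<Longrightarrow> F = P \<inter> {x. a F \<bullet> x = b F}"
    and halfspaces: "P = {x. \<forall>F. F facet_of P \<longrightarrow> a F \<bullet> x \<le> b F}"
begin

definition facets_at :: "'a \<Rightarrow> 'a set set" where
  "facets_at x = {F. F facet_of P \<and> x \<in> F}"

lemma polytope: "polytope P"
  using simple by (simp add: simple_polytope_def)

lemma finite_facets: "finite {F. F facet_of P}"
  by (rule finite_polytope_facets[OF polytope])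

lemma finite_facets_at: "finite (facets_at x)"
  using finite_facets by (rule rev_finite_subset) (auto simp: facets_at_def)

lemma card_facets_at_le: "card (facets_at x) \<le> DIM('a)"
  using simple by (simp add: simple_polytope_def facets_at_def)

lemma mem_facet_iff: "F facet_of P \<Longrightarrow> x \<in> P \<Longrightarrow> x \<in> F \<longleftrightarrow> a F \<bullet> x = b F"
  using facet by blast

lemma facet_le: "F facet_of P \<Longrightarrow> x \<in> P \<Longrightarrow> a F \<bullet> x \<le> b F"
  using halfspaces by blast

text \<open>Tight inequalities persist by the sign condition, the finitely many slack ones by
  continuity for small \<open>e\<close>.\<close>

lemma feasible_direction:
  assumes v: "v \<in> P" and u: "\<And>F. F \<in> facets_at v \<Longrightarrow> a F \<bullet> u \<le> 0"
  shows "\<exists>e>0. v + e *\<^sub>R u \<in> P"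
proof -
  have "\<forall>\<^sub>F e in at_right 0. a F \<bullet> (v + e *\<^sub>R u) \<le> b F" if F: "F facet_of P" for F
  proof (cases "v \<in> F")
    case True
    then have "a F \<bullet> v = b F" "a F \<bullet> u \<le> 0"
      using mem_facet_iff[OF F v] u F by (auto simp: facets_at_def)
    then show ?thesis
      by (intro eventually_at_rightI[of 0 1]) (auto simp: inner_simps mult_nonneg_nonpos)
  next
    case False
    then have "a F \<bullet> (v + 0 *\<^sub>R u) < b F"
      using mem_facet_iff[OF F v] facet_le[OF F v] by simp
    moreover have "((\<lambda>e. a F \<bullet> (v + e *\<^sub>R u)) \<longlongrightarrow> a F \<bullet> (v + 0 *\<^sub>R u)) (at_right 0)"
      by (intro tendsto_intros)
    ultimately have "\<forall>\<^sub>F e in at_right 0. a F \<bullet> (v + e *\<^sub>R u) < b F"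
      by (simp add: order_tendsto_iff)
    then show ?thesis by eventually_elim simp
  qed
  then have "\<forall>\<^sub>F e in at_right 0. \<forall>F\<in>{F. F facet_of P}. a F \<bullet> (v + e *\<^sub>R u) \<le> b F"
    by (intro eventually_ball_finite finite_facets) auto
  moreover have "\<forall>\<^sub>F e in at_right (0::real). e > 0"
    by (rule eventually_at_right_less)
  ultimately have "\<forall>\<^sub>F e in at_right 0. e > 0 \<and> v + e *\<^sub>R u \<in> P"
  proof eventually_elim
    case (elim e)
    then show ?case using halfspaces by blast
  qed
  then show ?thesis
    using eventually_happens by fastforce
qed

text \<open>A nonzero direction orthogonal to all normals at \<open>v\<close> could be followed both
  ways inside \<open>P\<close>, placing \<open>v\<close> inside a segment. So the normals at a
  vertex span the space.\<close>

lemma vertex_normals_determine: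
  assumes v: "v extreme_point_of P" and u: "\<And>F. F \<in> facets_at v \<Longrightarrow> a F \<bullet> u = 0"
  shows "u = 0"
proof (rule ccontr)
  assume "u \<noteq> 0"
  have vP: "v \<in> P" using v by (simp add: extreme_point_of_def)
  obtain e where e: "e > 0" "v + e *\<^sub>R u \<in> P"
    using feasible_direction[OF vP, of u] u by auto
  obtain d where d: "d > 0" "v + d *\<^sub>R (- u) \<in> P"
    using feasible_direction[OF vP, of "-u"] u by auto
  define t where "t = d / (d + e)"
  have t: "0 < t" "t < 1" "t * (d + e) = d" using e d by (auto simp: t_def)
  have "(1 - t) *\<^sub>R (v + d *\<^sub>R (- u)) + t *\<^sub>R (v + e *\<^sub>R u) = v + (t * (d + e) - d) *\<^sub>R u"
    by (simp add: algebra_simps)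
  then have "v = (1 - t) *\<^sub>R (v + d *\<^sub>R (- u)) + t *\<^sub>R (v + e *\<^sub>R u)" using t by simp
  moreover have "v + d *\<^sub>R (- u) \<noteq> v + e *\<^sub>R u"
  proof
    assume "v + d *\<^sub>R (- u) = v + e *\<^sub>R u"
    then have "(d + e) *\<^sub>R u = 0" by (simp add: algebra_simps)
    then show False using e d \<open>u \<noteq> 0\<close> by simp
  qed
  ultimately have "v \<in> open_segment (v + d *\<^sub>R (- u)) (v + e *\<^sub>R u)"
    using t by (auto simp: in_segment)
  then show False using v e d by (auto simp: extreme_point_of_def)
qed

lemma orthogonal_to_few_normals:
  assumes "finite S" "card S < DIM('a)"
  obtains u where "u \<noteq> 0" "\<And>F. F \<in> S \<Longrightarrow> a F \<bullet> u = 0"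
proof -
  have "dim (a ` S) < DIM('a)"
    using dim_le_card'[of "a ` S"] card_image_le[OF assms(1), of a] assms by simp
  then obtain u where "u \<noteq> 0" "\<And>y. y \<in> span (a ` S) \<Longrightarrow> orthogonal u y"
    by (rule orthogonal_to_subspace_exists) blast
  then show thesis
    using that by (metis image_eqI inner_commute orthogonal_def span_base)
qed

lemma card_facets_at_vertex:
  assumes "v extreme_point_of P"
  shows "card (facets_at v) = DIM('a)"
proof (rule antisym[OF card_facets_at_le])
  show "DIM('a) \<le> card (facets_at v)"
  proof (rule ccontr)
    assume "\<not> ?thesis"
    then obtain u where "u \<noteq> 0" "\<And>F. F \<in> facets_at v \<Longrightarrow> a F \<bullet> u = 0"
      using orthogonal_to_few_normals[OF finite_facets_at, of v] by (metis not_le)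
    then show False using vertex_normals_determine[OF assms] by blast
  qed
qed

text \<open>The facets at \<open>v\<close> other than \<open>F\<close> have too few normals to span,
  which leaves a direction along all of them that departs from \<open>F\<close>. Their common face
  \<open>K\<close> thus has a point off \<open>F\<close>, hence an extreme point off
  \<open>F\<close>. That \<open>K\<close> is an edge is never shown; only the incidences of
  \<open>w\<close> matter.\<close>

lemma vertex_neighbour:
  assumes v: "v extreme_point_of P" and F: "F \<in> facets_at v"
  shows "\<exists>w. w extreme_point_of P \<and> w \<notin> F \<and> (\<forall>G\<in>facets_at v - {F}. w \<in> G)"
proof -
  let ?S = "facets_at v - {F}"
  have vP: "v \<in> P" using v by (simp add: extreme_point_of_def)
  have FP: "F facet_of P" and vF: "v \<in> F" using F by (auto simp: facets_at_def)
  have "card ?S < DIM('a)"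
    using card_facets_at_vertex[OF v] F finite_facets_at by (metis card_Diff1_less)
  then obtain u where u: "u \<noteq> 0" "\<And>G. G \<in> ?S \<Longrightarrow> a G \<bullet> u = 0"
    using orthogonal_to_few_normals[of ?S] finite_facets_at by (metis finite_Diff)
  have "a F \<bullet> u \<noteq> 0" using vertex_normals_determine[OF v, of u] u by blast
  \<comment> \<open>The sign is chosen so that the direction points into \<open>P\<close>.\<close>
  define u' where "u' = (if a F \<bullet> u < 0 then u else - u)"
  have u': "a F \<bullet> u' < 0" "\<And>G. G \<in> ?S \<Longrightarrow> a G \<bullet> u' = 0"
    using \<open>a F \<bullet> u \<noteq> 0\<close> u by (auto simp: u'_def)
  obtain e where e: "e > 0" "v + e *\<^sub>R u' \<in> P"
    using feasible_direction[OF vP, of u'] u' by force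
  have nF: "v + e *\<^sub>R u' \<notin> F"
    using mem_facet_iff[OF FP e(2)] mem_facet_iff[OF FP vP] vF u' e by (simp add: inner_simps)
  \<comment> \<open>Inserting \<open>P\<close> keeps the intersected family nonempty in dimension
    one.\<close>
  define K where "K = \<Inter> (insert P ?S)"
  have KP: "K face_of P"
    unfolding K_def
    using face_of_refl[OF polytope_imp_convex[OF polytope]]
    by (intro face_of_Inter) (auto simp: facets_at_def facet_of_imp_face_of)
  have "v + e *\<^sub>R u' \<in> G" if G: "G \<in> ?S" for G
    using mem_facet_iff[of G, OF _ e(2)] mem_facet_iff[of G, OF _ vP] G u'(2)[OF G]
    by (auto simp: facets_at_def inner_simps)
  then have inK: "v + e *\<^sub>R u' \<in> K" using e by (auto simp: K_def)
  have "compact K" "convex K"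
    using KP polytope polytope_imp_compact face_of_imp_compact polytope_imp_convex face_of_imp_convex
    by blast+
  then have "K = convex hull {x. x extreme_point_of K}"
    by (rule Krein_Milman_Minkowski)
  moreover have "convex F" using FP facet_of_imp_face_of face_of_imp_convex by blast
  ultimately have "\<not> {x. x extreme_point_of K} \<subseteq> F"
    using inK nF hull_minimal[of "{x. x extreme_point_of K}" F convex] by blast
  then obtain w where "w extreme_point_of K" "w \<notin> F" by blast
  then have "w extreme_point_of P" "w \<in> K" "w \<notin> F" using extreme_point_of_face[OF KP] by auto
  then show ?thesis by (auto simp: K_def)
qed

end

text \<open>At a vertex of a simple polytope the vectors to its neighbours form a basis, dual up to scaling
  to the normals of the facets through the vertex.\<close>
locale simple_vertex = simple_polytope_halfspaces +
  fixes v and w :: "'a set \<Rightarrow> 'a"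
  assumes vertex: "v extreme_point_of P"
    and neighbour: "\<And>F. F \<in> facets_at v \<Longrightarrow> w F extreme_point_of P"
    and neighbour_notin: "\<And>F. F \<in> facets_at v \<Longrightarrow> w F \<notin> F"
    and neighbour_in: "\<And>F G. F \<in> facets_at v \<Longrightarrow> G \<in> facets_at v \<Longrightarrow> F \<noteq> G \<Longrightarrow> w F \<in> G"
begin

text \<open>The dual basis functional belonging to \<open>w F - v\<close>; the quotient removes the
  scale and sign of the normal.\<close>

definition coord :: "'a set \<Rightarrow> 'a \<Rightarrow> real" where
  "coord F x = (a F \<bullet> (x - v)) / (a F \<bullet> (w F - v))"

lemma vertex_in: "v \<in> P"
  using vertex by (simp add: extreme_point_of_def)

lemma neighbour_in_P: "F \<in> facets_at v \<Longrightarrow> w F \<in> P"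
  using neighbour by (simp add: extreme_point_of_def)

lemma normal_vertex: "F \<in> facets_at v \<Longrightarrow> a F \<bullet> v = b F"
  using vertex_in mem_facet_iff by (auto simp: facets_at_def)

lemma normal_neighbour: "F \<in> facets_at v \<Longrightarrow> a F \<bullet> (w F - v) < 0"
  using normal_vertex[of F] neighbour_notin[of F] facet_le[of F "w F"] mem_facet_iff[of F "w F"] neighbour_in_P[of F]
  by (auto simp: facets_at_def inner_simps)

lemma normal_neighbour_other:
  "F \<in> facets_at v \<Longrightarrow> G \<in> facets_at v \<Longrightarrow> F \<noteq> G \<Longrightarrow> a G \<bullet> (w F - v) = 0"
  using normal_vertex[of G] neighbour_in[of F G] mem_facet_iff[of G "w F"] neighbour_in_P[of F]
  by (auto simp: facets_at_def inner_simps)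

lemma coord_neighbour:
  assumes "F \<in> facets_at v" "G \<in> facets_at v"
  shows "coord F (w G) = (if F = G then 1 else 0)"
  using assms normal_neighbour[of F] normal_neighbour_other[of G F] by (auto simp: coord_def)

lemma coord_nonneg:
  assumes "F \<in> facets_at v" "x \<in> P"
  shows "0 \<le> coord F x"
proof -
  have "a F \<bullet> (x - v) \<le> 0"
    using assms facet_le[of F x] normal_vertex[of F] by (auto simp: facets_at_def inner_simps)
  then show ?thesis
    using normal_neighbour[OF assms(1)] by (simp add: coord_def divide_nonpos_neg)
qed

lemma coord_facet:
  assumes "F \<in> facets_at v" "x \<in> F"
  shows "coord F x = 0"
  using assms facet[of F] normal_vertex[of F] by (auto simp: coord_def facets_at_def inner_simps)

text \<open>Both sides have the same inner product with every normal at \<open>v\<close>, and these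
  normals determine a vector.\<close>

lemma coord_expansion: "x - v = (\<Sum>F\<in>facets_at v. coord F x *\<^sub>R (w F - v))"
proof -
  have "x - v - (\<Sum>F\<in>facets_at v. coord F x *\<^sub>R (w F - v)) = 0"
  proof (rule vertex_normals_determine[OF vertex])
    fix G assume G: "G \<in> facets_at v"
    have "a G \<bullet> (\<Sum>F\<in>facets_at v. coord F x *\<^sub>R (w F - v))
        = (\<Sum>F\<in>facets_at v. coord F x * (a G \<bullet> (w F - v)))"
      by (simp add: inner_sum_right)
    also have "\<dots> = (\<Sum>F\<in>facets_at v. if F = G then a G \<bullet> (x - v) else 0)"
      using normal_neighbour[OF G] normal_neighbour_other[OF _ G]
      by (intro sum.cong) (auto simp: coord_def)
    also have "\<dots> = a G \<bullet> (x - v)"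
      using G finite_facets_at by simp
    finally show "a G \<bullet> (x - v - (\<Sum>F\<in>facets_at v. coord F x *\<^sub>R (w F - v))) = 0"
      by (simp add: inner_diff_right)
  qed
  then show ?thesis by simp
qed

lemma linear_coord_expansion:
  assumes "linear L"
  shows "L x - L v = (\<Sum>F\<in>facets_at v. coord F x *\<^sub>R (L (w F) - L v))"
proof -
  have "L x - L v = L (\<Sum>F\<in>facets_at v. coord F x *\<^sub>R (w F - v))"
    using linear_diff[OF assms, of x v] coord_expansion[of x] by simp
  also have "\<dots> = (\<Sum>F\<in>facets_at v. coord F x *\<^sub>R (L (w F) - L v))"
    by (simp add: linear_sum[OF assms] linear_scale[OF assms] linear_diff[OF assms])
  finally show ?thesis .
qed

text \<open>On \<open>F\<close> the coordinate of \<open>w F\<close> vanishes, so values there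
  depend only on those at \<open>v\<close> and at the neighbours lying in \<open>F\<close>.\<close>

lemma affine_agree_on_facet:
  assumes F: "F \<in> facets_at v" and L: "linear L" "linear L'"
    and v: "L v + c = L' v + c'"
    and w: "\<And>G. G \<in> facets_at v \<Longrightarrow> G \<noteq> F \<Longrightarrow> L (w G) + c = L' (w G) + c'"
    and x: "x \<in> F"
  shows "L x + c = L' x + c'"
proof -
  have "L (w G) - L v = L' (w G) - L' v" if "G \<in> facets_at v" "G \<noteq> F" for G
    using w[OF that] v by (metis add_diff_cancel_right)
  then have "L x - L v = L' x - L' v"
    unfolding linear_coord_expansion[OF L(1), of x] linear_coord_expansion[OF L(2), of x]
    using coord_facet[OF F x] by (intro sum.cong refl) (metis scale_zero_left)
  then show ?thesis using v by (metis add.commute add_diff_cancel_right diff_add_cancel add.assoc)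
qed

lemma interpolation:
  fixes \<phi> :: "'a \<Rightarrow> 'b::real_vector"
  obtains L c where "linear L" "L v + c = \<phi> v" "\<And>F. F \<in> facets_at v \<Longrightarrow> L (w F) + c = \<phi> (w F)"
proof -
  \<comment> \<open>Using \<open>a F \<bullet> x\<close> in place of
    \<open>a F \<bullet> (x - v)\<close> keeps \<open>L\<close> linear; the difference goes into the
    constant \<open>\<phi> v - L v\<close>.\<close>
  define L where "L x = (\<Sum>F\<in>facets_at v. ((a F \<bullet> x) / (a F \<bullet> (w F - v))) *\<^sub>R (\<phi> (w F) - \<phi> v))" for x
  have "linear L"
    unfolding L_def
    by (rule linearI)
       (simp_all add: inner_simps add_divide_distrib scaleR_left.add sum.distrib scaleR_sum_right)
  moreover have d: "L x - L v = (\<Sum>F\<in>facets_at v. coord F x *\<^sub>R (\<phi> (w F) - \<phi> v))" for x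
    by (simp add: L_def coord_def inner_simps diff_divide_distrib scaleR_left.diff sum_subtractf)
  have "L (w F) + (\<phi> v - L v) = \<phi> (w F)" if F: "F \<in> facets_at v" for F
  proof -
    have "L (w F) - L v = (\<Sum>G\<in>facets_at v. if G = F then \<phi> (w F) - \<phi> v else 0)"
      unfolding d using F by (intro sum.cong) (auto simp: coord_neighbour)
    also have "\<dots> = \<phi> (w F) - \<phi> v" using F finite_facets_at by simp
    finally show ?thesis by (simp add: algebra_simps)
  qed
  ultimately show thesis by (intro that[of L "\<phi> v - L v"]) auto
qed

text \<open>\<open>P\<close> lies in the cone at \<open>v\<close> generated by the vectors
  \<open>w F - v\<close>. A functional that increases along none of them cannot increase anywhere in
  \<open>P\<close>: local optimality is global, as in the simplex method.\<close>

lemma improving_neighbour: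
  assumes x: "x \<in> P" "c \<bullet> v < c \<bullet> x"
  shows "\<exists>F\<in>facets_at v. c \<bullet> v < c \<bullet> w F"
proof (rule ccontr)
  assume "\<not> ?thesis"
  then have "\<And>F. F \<in> facets_at v \<Longrightarrow> c \<bullet> (w F - v) \<le> 0" by (auto simp: inner_simps)
  then have "(\<Sum>F\<in>facets_at v. coord F x * (c \<bullet> (w F - v))) \<le> 0"
    using coord_nonneg[OF _ x(1)] by (intro sum_nonpos) (simp add: mult_nonneg_nonpos)
  moreover have "c \<bullet> (x - v) = (\<Sum>F\<in>facets_at v. coord F x * (c \<bullet> (w F - v)))"
    by (subst coord_expansion) (simp add: inner_sum_right)
  ultimately show False using x by (simp add: inner_simps)
qed

end

lemma (in simple_polytope_halfspaces) simple_vertex_exists: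
  assumes "v extreme_point_of P"
  obtains w where "simple_vertex P a b v w"
proof -
  obtain w where "\<And>F. F \<in> facets_at v \<Longrightarrow>
      w F extreme_point_of P \<and> w F \<notin> F \<and> (\<forall>G\<in>facets_at v - {F}. w F \<in> G)"
    using vertex_neighbour[OF assms] by metis
  then have "simple_vertex P a b v w"
    using assms by unfold_locales auto
  then show thesis by (rule that)
qed

text \<open>A facet is good if the affine map interpolating \<open>\<phi>\<close> around a fixed vertex \<open>v0\<close> agrees with \<open>\<phi>\<close> on it.
  Goodness of all facets at a vertex passes to adjacent vertices, and by the simplex method every
  vertex is joined to \<open>v0\<close> by an edge path along which a functional exposing \<open>v0\<close> increases.\<close>
theorem affine_on_facets_imp_affine:
  fixes P :: "'a::euclidean_space set" and \<phi> :: "'a \<Rightarrow> 'b::real_vector"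
  assumes simple: "simple_polytope P" and dim: "3 \<le> DIM('a)"
    and aff: "\<And>F. F facet_of P \<Longrightarrow>
      \<exists>L c. linear L \<and> (\<forall>x. x extreme_point_of P \<longrightarrow> x \<in> F \<longrightarrow> \<phi> x = L x + c)"
  shows "\<exists>L c. linear L \<and> (\<forall>x. x extreme_point_of P \<longrightarrow> \<phi> x = L x + c)"
proof -
  have "polytope P" "affine hull P = UNIV" using simple by (auto simp: simple_polytope_def)
  then have P: "polyhedron P" "compact P" "convex P" "P \<noteq> {}"
    by (auto simp: polytope_imp_polyhedron polytope_imp_compact polytope_imp_convex)
  obtain a b where "\<And>F. F facet_of P \<Longrightarrow> F = P \<inter> {x. a F \<bullet> x = b F}"
      "P = {x. \<forall>F. F facet_of P \<longrightarrow> a F \<bullet> x \<le> b F}"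
    by (rule polyhedron_facet_halfspaces[OF P(1) \<open>affine hull P = UNIV\<close>]) blast
  then interpret simple_polytope_halfspaces P a b
    using simple by unfold_locales
  have "{x. x extreme_point_of P} \<noteq> {}"
    using Krein_Milman_Minkowski[OF P(2,3)] P(4) by auto
  then obtain v0 where v0: "v0 extreme_point_of P" by blast
  \<comment> \<open>Extreme points of polyhedra are exposed, so some functional \<open>c0\<close>
    attains its maximum over \<open>P\<close> at \<open>v0\<close> alone; it measures progress
    towards \<open>v0\<close>.\<close>
  then have "{v0} exposed_face_of P"
    using P(1) by (simp add: exposed_face_of_polyhedron face_of_singleton)
  then obtain c0 d where c0: "P \<subseteq> {x. c0 \<bullet> x \<le> d}" "{v0} = P \<inter> {x. c0 \<bullet> x = d}"
    by (auto simp: exposed_face_of_def)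
  have v0_max: "c0 \<bullet> x < c0 \<bullet> v0" if "x \<in> P" "x \<noteq> v0" for x
  proof -
    have "c0 \<bullet> v0 = d" using c0(2) by blast
    moreover have "c0 \<bullet> x \<le> d" using c0(1) that by blast
    moreover have "c0 \<bullet> x \<noteq> d" using c0(2) that by blast
    ultimately show ?thesis by simp
  qed
  obtain w0 where "simple_vertex P a b v0 w0"
    using simple_vertex_exists[OF v0] by blast
  then interpret v0: simple_vertex P a b v0 w0 .
  obtain L c where L: "linear L" and Lv0: "L v0 + c = \<phi> v0"
      and Lw0: "\<And>F. F \<in> facets_at v0 \<Longrightarrow> L (w0 F) + c = \<phi> (w0 F)"
    using v0.interpolation[of \<phi>] by blast
  define good where "good F \<longleftrightarrow> (\<forall>x. x extreme_point_of P \<longrightarrow> x \<in> F \<longrightarrow> \<phi> x = L x + c)" for F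
  \<comment> \<open>The affine map that \<open>aff\<close> supplies on \<open>F\<close> agrees with
    \<open>L x + c\<close> at \<open>v\<close> and at the neighbours of \<open>v\<close> in
    \<open>F\<close>, hence on all of \<open>F\<close>.\<close>
  have extend: "good F"
    if sv: "simple_vertex P a b v w" and F: "F \<in> facets_at v" and v: "\<phi> v = L v + c"
      and w: "\<And>G. G \<in> facets_at v \<Longrightarrow> G \<noteq> F \<Longrightarrow> \<phi> (w G) = L (w G) + c" for v w F
  proof -
    interpret sv: simple_vertex P a b v w by (fact sv)
    obtain L' c' where L': "linear L'" "\<And>x. x extreme_point_of P \<Longrightarrow> x \<in> F \<Longrightarrow> \<phi> x = L' x + c'"
      using aff[of F] F by (auto simp: facets_at_def)
    have 1: "L v + c = L' v + c'"
      using L'(2)[OF sv.vertex] F v by (simp add: facets_at_def)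
    have 2: "L (w G) + c = L' (w G) + c'" if "G \<in> facets_at v" "G \<noteq> F" for G
      using L'(2)[OF sv.neighbour[OF that(1)] sv.neighbour_in[OF that(1) F that(2)]] w[OF that] by simp
    show ?thesis
      unfolding good_def using sv.affine_agree_on_facet[OF F L L'(1) 1 2] L'(2) by simp
  qed
  have good_v0: "good F" if "F \<in> facets_at v0" for F
    using extend[OF v0.simple_vertex_axioms that] Lv0 Lw0 by simp
  have good_vertex: "\<forall>F\<in>facets_at v. good F" if v: "v extreme_point_of P" for v
  proof (rule ccontr)
    define B where "B = {v. v extreme_point_of P \<and> \<not> (\<forall>F\<in>facets_at v. good F)}"
    assume "\<not> ?thesis"
    then have "B \<noteq> {}" using v by (auto simp: B_def)
    moreover have "finite B"
      using finite_polyhedron_extreme_points[OF P(1)] by (rule rev_finite_subset) (auto simp: B_def)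
    \<comment> \<open>For a bad vertex with the largest value of \<open>c0\<close>, the improving
      neighbour is strictly higher and therefore not bad.\<close>
    ultimately obtain v where vB: "v \<in> B" and vmax: "\<And>x. x \<in> B \<Longrightarrow> c0 \<bullet> x \<le> c0 \<bullet> v"
      by (metis obtains_MAX Max_ge finite_imageI imageI)
    have v: "v extreme_point_of P" using vB by (simp add: B_def)
    have "v \<noteq> v0" using vB good_v0 by (auto simp: B_def)
    then have lt: "c0 \<bullet> v < c0 \<bullet> v0" using v0_max v by (auto simp: extreme_point_of_def)
    obtain w where "simple_vertex P a b v w" using simple_vertex_exists[OF v] by blast
    then interpret v: simple_vertex P a b v w .
    obtain F where F: "F \<in> facets_at v" and Flt: "c0 \<bullet> v < c0 \<bullet> w F"
      using v.improving_neighbour[OF v0.vertex_in lt] by blast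
    have "w F \<notin> B" using vmax[of "w F"] Flt by auto
    then have "\<forall>G\<in>facets_at (w F). good G" using v.neighbour[OF F] by (auto simp: B_def)
    then have other: "good G" if "G \<in> facets_at v" "G \<noteq> F" for G
      using that v.neighbour_in[OF F that(1)] by (auto simp: facets_at_def)
    have card3: "3 \<le> card (facets_at v)" using card_facets_at_vertex[OF v] dim by simp
    \<comment> \<open>Here dimension at least three enters. A neighbour \<open>w G\<close> with
      \<open>G \<noteq> F\<close> lies on a facet \<open>H\<close> at \<open>v\<close> different
      from \<open>F\<close> and \<open>G\<close>; such an \<open>H\<close> is already good, so the
      value of \<open>\<phi>\<close> at \<open>w G\<close> is known.\<close>
    have third: "\<exists>H\<in>facets_at v. H \<noteq> F \<and> H \<noteq> G" for G
    proof (rule ccontr)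
      assume "\<not> ?thesis"
      then have "facets_at v \<subseteq> {F, G}" by blast
      then have "card (facets_at v) \<le> card {F, G}" by (intro card_mono) auto
      also have "\<dots> \<le> 2" by (simp add: card_insert_if)
      finally show False using card3 by simp
    qed
    have "good F"
    proof (rule extend[OF v.simple_vertex_axioms F])
      obtain H where H: "H \<in> facets_at v" "H \<noteq> F" using third by blast
      then show "\<phi> v = L v + c" using other[OF H] v by (auto simp: good_def facets_at_def)
    next
      fix G assume G: "G \<in> facets_at v" "G \<noteq> F"
      obtain H where H: "H \<in> facets_at v" "H \<noteq> F" "H \<noteq> G" using third by blast
      then show "\<phi> (w G) = L (w G) + c"
        using other[OF H(1,2)] v.neighbour[OF G(1)] v.neighbour_in[OF G(1) H(1)] by (auto simp: good_def)
    qed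
    then show False using vB other by (auto simp: B_def)
  qed
  have "\<phi> x = L x + c" if x: "x extreme_point_of P" for x
  proof -
    have "facets_at x \<noteq> {}" using card_facets_at_vertex[OF x] dim by auto
    then obtain F where "F \<in> facets_at x" by blast
    then show ?thesis using good_vertex[OF x] x by (auto simp: good_def facets_at_def)
  qed
  then show ?thesis using L by blast
qed

section \<open>Affine equivalence of polyhedra\<close>

lemma aff_dim_pt_eq_3_iff: "aff_dim (P :: pt set) = 3 \<longleftrightarrow> affine hull P = UNIV"
  using aff_dim_eq_full[of P] by simp

lemma nondeg_affine_inj:
  assumes "nondeg_affine A"
  shows "inj A"
proof -
  obtain L c where L: "invertible L" "\<And>x. A x = L *v x + c"
    using assms by (auto simp: nondeg_affine_def)
  then show ?thesis
    using invertible_eq_bij[of L] by (auto simp: inj_on_def bij_def)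
qed

lemma nondeg_affine_image:
  assumes "nondeg_affine A"
  obtains L c where "linear L" "inj L" "\<And>S. A ` S = (+) c ` L ` S"
proof -
  obtain M c where M: "invertible M" "\<And>x. A x = M *v x + c"
    using assms by (auto simp: nondeg_affine_def)
  show thesis
  proof (rule that[of "(*v) M" c])
    show "inj ((*v) M)" using M invertible_eq_bij[of M] by (simp add: bij_def)
    show "A ` S = (+) c ` (*v) M ` S" for S
      using M by (auto simp: image_image add.commute)
  qed (rule matrix_vector_mul_linear)
qed

lemma nondeg_affine_face_of_iff:
  assumes "nondeg_affine A"
  shows "A ` F face_of A ` P \<longleftrightarrow> F face_of P"
proof -
  obtain L c where "linear L" "inj L" "\<And>S. A ` S = (+) c ` L ` S"
    by (rule nondeg_affine_image[OF assms]) blast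
  then show ?thesis by (simp add: face_of_linear_image)
qed

lemma nondeg_affine_aff_dim:
  assumes "nondeg_affine A"
  shows "aff_dim (A ` S) = aff_dim S"
proof -
  obtain L c where "linear L" "inj L" "\<And>S. A ` S = (+) c ` L ` S"
    by (rule nondeg_affine_image[OF assms]) blast
  then show ?thesis by (simp add: aff_dim_translation_eq aff_dim_injective_linear_image)
qed

lemma affine_equivalent_imp_faces_affine_equivalent:
  assumes "affine_equivalent P P'"
  shows "faces_affine_equivalent P P'"
proof -
  obtain A where A: "nondeg_affine A" and P': "P' = A ` P"
    using assms by (auto simp: affine_equivalent_def)
  note inj = nondeg_affine_inj[OF A]
  \<comment> \<open>The predicate \<open>R\<close> selects faces by emptiness and dimension, both
    preserved by \<open>A\<close>, so one bijection serves vertices, edges and facets.\<close>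
  have bij: "bij_betw ((`) A) {S. S face_of P \<and> R (S = {}) (aff_dim S)}
                             {S. S face_of P' \<and> R (S = {}) (aff_dim S)}" for R
  proof (rule bij_betw_imageI)
    show "inj_on ((`) A) {S. S face_of P \<and> R (S = {}) (aff_dim S)}"
      using inj by (auto simp: inj_on_def inj_image_eq_iff)
    show "(`) A ` {S. S face_of P \<and> R (S = {}) (aff_dim S)} = {S. S face_of P' \<and> R (S = {}) (aff_dim S)}"
    proof (intro equalityI subsetI)
      fix T assume T: "T \<in> {S. S face_of P' \<and> R (S = {}) (aff_dim S)}"
      then have "T \<subseteq> A ` P" using P' face_of_imp_subset by blast
      then obtain S where "T = A ` S" by (meson subset_image_iff)
      then show "T \<in> (`) A ` {S. S face_of P \<and> R (S = {}) (aff_dim S)}"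
        using T P' nondeg_affine_face_of_iff[OF A] nondeg_affine_aff_dim[OF A] by auto
    qed (use P' nondeg_affine_face_of_iff[OF A] nondeg_affine_aff_dim[OF A] in auto)
  qed
  have "bij_betw ((`) A) (vertices P) (vertices P')"
    using bij[of "\<lambda>e d. d = 0"] by (simp add: vertices_def)
  moreover have "bij_betw ((`) A) (edges P) (edges P')"
    using bij[of "\<lambda>e d. d = 1"] by (simp add: edges_def edge_of_def)
  moreover have "bij_betw ((`) A) (faces2 P) (faces2 P')"
    using bij[of "\<lambda>e d. \<not> e \<and> d = aff_dim P - 1"]
    by (simp add: faces2_def facet_of_def P' nondeg_affine_aff_dim[OF A])
  ultimately have "comb_equiv P P' ((`) A) ((`) A) ((`) A)"
    using inj by (simp add: comb_equiv_def inj_image_subset_iff)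
  then show ?thesis
    unfolding faces_affine_equivalent_def using A by blast
qed

lemma vertices_eq: "vertices P = {{x} |x. x extreme_point_of P}"
  by (auto simp: vertices_def aff_dim_eq_0 face_of_singleton)

text \<open>Once the vertex map is affine, it carries extreme points onto extreme points, hence
  convex hull onto convex hull.\<close>

lemma faces_affine_equivalent_imp_affine_equivalent:
  assumes simple: "simple_polytope P" and P': "strictly_convex_polyhedron P'"
    and eq: "faces_affine_equivalent P P'"
  shows "affine_equivalent P P'"
proof -
  obtain fv fe ff where comb: "comb_equiv P P' fv fe ff"
    and maps: "\<And>F. F \<in> faces2 P \<Longrightarrow> \<exists>A. nondeg_affine A \<and> (\<forall>v\<in>vertices P. v \<subseteq> F \<longrightarrow> A ` v = fv v)"
    using eq unfolding faces_affine_equivalent_def by meson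
  have bij: "bij_betw fv (vertices P) (vertices P')" using comb by (simp add: comb_equiv_def)
  \<comment> \<open>Vertices are encoded as singleton faces; \<open>\<phi>\<close> acts on the
    underlying points.\<close>
  define \<phi> where "\<phi> x = the_elem (fv {x})" for x
  have fv: "fv {x} = {\<phi> x}" if "x extreme_point_of P" for x
  proof -
    have "{x} \<in> vertices P" using that by (simp add: vertices_eq)
    then have "fv {x} \<in> vertices P'" using bij_betwE[OF bij] by blast
    then obtain y where "fv {x} = {y}" unfolding vertices_eq by blast
    then show ?thesis by (simp add: \<phi>_def)
  qed
  have "\<exists>L c. linear L \<and> (\<forall>x. x extreme_point_of P \<longrightarrow> x \<in> F \<longrightarrow> \<phi> x = L x + c)" if F: "F facet_of P" for F
  proof -
    obtain A where A: "nondeg_affine A" "\<And>v. v \<in> vertices P \<Longrightarrow> v \<subseteq> F \<Longrightarrow> A ` v = fv v"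
      using maps[of F] F by (auto simp: faces2_def)
    obtain M c where M: "\<And>x. A x = M *v x + c"
      using A(1) by (auto simp: nondeg_affine_def)
    have "\<phi> x = M *v x + c" if "x extreme_point_of P" "x \<in> F" for x
      using A(2)[of "{x}"] that fv[OF that(1)] M by (auto simp: vertices_eq)
    then show ?thesis using matrix_vector_mul_linear[of M] by blast
  qed
  then have "\<exists>L c. linear L \<and> (\<forall>x. x extreme_point_of P \<longrightarrow> \<phi> x = L x + c)"
    by (intro affine_on_facets_imp_affine[OF simple]) simp_all
  then obtain L c where L: "linear L" and Lc: "\<And>x. x extreme_point_of P \<Longrightarrow> \<phi> x = L x + c"
    by blast
  define A where "A x = L x + c" for x
  have A_image: "A ` S = (+) c ` L ` S" for S
    by (auto simp: A_def image_image add.commute)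
  have "(\<lambda>x. {A x}) ` {x. x extreme_point_of P} = (\<lambda>x. {x}) ` {x. x extreme_point_of P'}"
  proof -
    have "(\<lambda>x. {A x}) ` {x. x extreme_point_of P} = (\<lambda>x. fv {x}) ` {x. x extreme_point_of P}"
      using fv Lc by (intro image_cong) (auto simp: A_def)
    also have "\<dots> = fv ` vertices P" by (auto simp: vertices_eq)
    also have "\<dots> = vertices P'" using bij by (simp add: bij_betw_def)
    finally show ?thesis by (auto simp: vertices_eq)
  qed
  then have ext: "A ` {x. x extreme_point_of P} = {x. x extreme_point_of P'}"
    by (subst inj_image_eq_iff[of "\<lambda>x. {x}", symmetric]) (auto simp: image_image)
  have "polytope P" "polytope P'" using simple P' by (auto simp: simple_polytope_def strictly_convex_polyhedron_def)
  then have hull: "P = convex hull {x. x extreme_point_of P}" "P' = convex hull {x. x extreme_point_of P'}"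
    by (simp_all add: Krein_Milman_Minkowski polytope_imp_compact polytope_imp_convex)
  have AP: "A ` P = P'"
  proof -
    have "A ` P = convex hull (A ` {x. x extreme_point_of P})"
      by (subst hull(1)) (simp add: A_image convex_hull_translation convex_hull_linear_image[OF L])
    then show ?thesis using ext hull(2) by simp
  qed
  \<comment> \<open>Both hulls are the whole space, so \<open>A\<close> is onto. Hence its linear
    part is onto, and injective by finite dimension.\<close>
  have "A ` (affine hull P) = affine hull P'"
    unfolding AP[symmetric] A_image
    by (simp add: affine_hull_translation affine_hull_linear_image L linear_conv_bounded_linear[symmetric])
  then have "range A = UNIV"
    using simple P' by (simp add: simple_polytope_def strictly_convex_polyhedron_def aff_dim_pt_eq_3_iff)
  have "y \<in> range L" for y
  proof -
    have "y + c \<in> range A" using \<open>range A = UNIV\<close> by simp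
    then show ?thesis by (auto simp: A_def)
  qed
  then have "surj L" by blast
  then have "bij L"
    using L linear_surjective_imp_injective by (auto simp: bij_def)
  then have "invertible (matrix L)"
    using matrix_vector_mul(2)[OF L] by (simp add: invertible_eq_bij)
  then have "nondeg_affine A"
    unfolding nondeg_affine_def A_def using fun_cong[OF matrix_vector_mul(2)[OF L]] by metis
  then show ?thesis using AP by (auto simp: affine_equivalent_def)
qed


section \<open>Openness\<close>

text \<open>A real supremum dominates its members only when they are bounded above; bounded nonempty
  sets guarantee this.\<close>

lemma infdist_le_hausdorff_dist:
  assumes S: "bounded S" "S \<noteq> {}" and T: "bounded T" "T \<noteq> {}"
  shows "x \<in> S \<Longrightarrow> infdist x T \<le> hausdorff_dist S T"
    and "y \<in> T \<Longrightarrow> infdist y S \<le> hausdorff_dist S T"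
proof -
  have bdd: "bdd_above ((\<lambda>x. infdist x T) ` S)" if S: "bounded S" "T \<noteq> {}" for S T :: "pt set"
  proof -
    obtain t where t: "t \<in> T" using S by blast
    obtain e where "\<And>x. x \<in> S \<Longrightarrow> dist t x \<le> e" using S by (meson bounded_any_center)
    then have "infdist x T \<le> e" if "x \<in> S" for x
      using infdist_le[OF t, of x] that by (metis dist_commute order_trans)
    then show ?thesis by (rule bdd_aboveI2)
  qed
  show "x \<in> S \<Longrightarrow> infdist x T \<le> hausdorff_dist S T"
    using cSUP_upper[OF _ bdd[of S T]] S T by (fastforce simp: hausdorff_dist_def le_max_iff_disj)
  show "y \<in> T \<Longrightarrow> infdist y S \<le> hausdorff_dist S T"
    using cSUP_upper[OF _ bdd[of T S]] S T by (fastforce simp: hausdorff_dist_def le_max_iff_disj)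
qed

lemma hausdorff_dist_le:
  assumes "S \<noteq> {}" "T \<noteq> {}"
    and "\<And>x. x \<in> S \<Longrightarrow> infdist x T \<le> e" "\<And>y. y \<in> T \<Longrightarrow> infdist y S \<le> e"
  shows "hausdorff_dist S T \<le> e"
  unfolding hausdorff_dist_def using assms by (intro max.boundedI cSUP_least)

text \<open>Lets four concurrent facets receive the indices 0 to 3 in every polytope of a sequence,
  so that the same indices can be followed to the limit.\<close>

lemma bij_betw_extending_enumeration:
  assumes "finite X" "J \<subseteq> X"
  obtains f where "bij_betw f {..<card X} X" "f ` {..<card J} = J"
proof -
  have "finite J" using assms finite_subset by blast
  then obtain g where g: "bij_betw g {..<card J} J"
    using ex_bij_betw_nat_finite lessThan_atLeast0 by metis
  have le: "card J \<le> card X" using assms by (simp add: card_mono)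
  have "card {card J..<card X} = card (X - J)"
    using assms \<open>finite J\<close> by (simp add: card_Diff_subset)
  then obtain h where h: "bij_betw h {card J..<card X} (X - J)"
    using assms finite_same_card_bij[of "{card J..<card X}" "X - J"] by auto
  define f where "f i = (if i < card J then g i else h i)" for i
  have fg: "bij_betw f {..<card J} J"
    using g by (subst bij_betw_cong[of _ _ g]) (auto simp: f_def)
  moreover have "bij_betw f {card J..<card X} (X - J)"
    using h by (subst bij_betw_cong[of _ _ h]) (auto simp: f_def)
  ultimately have "bij_betw f ({..<card J} \<union> {card J..<card X}) (J \<union> (X - J))"
    by (rule bij_betw_combine) auto
  moreover have "{..<card J} \<union> {card J..<card X} = {..<card X}" "J \<union> (X - J) = X"
    using le assms by auto
  ultimately show thesis using that fg by (simp add: bij_betw_def)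
qed

lemma convergent_subsequence_finite_family:
  fixes f :: "nat \<Rightarrow> nat \<Rightarrow> 'a::heine_borel"
  assumes "\<And>i. i < n \<Longrightarrow> bounded (range (\<lambda>k. f k i))"
  shows "\<exists>r l. strict_mono r \<and> (\<forall>i<n. (\<lambda>k. f (r k) i) \<longlonglongrightarrow> l i)"
  using assms
proof (induction n)
  case 0
  show ?case using strict_mono_id by blast
next
  case (Suc n)
  then obtain r l where r: "strict_mono r" "\<And>i. i < n \<Longrightarrow> (\<lambda>k. f (r k) i) \<longlonglongrightarrow> l i"
    by (metis less_SucI)
  have "bounded (range (\<lambda>k. f (r k) n))"
    using Suc.prems[of n] by (rule bounded_subset) auto
  then obtain l' r' where r': "strict_mono r'" "((\<lambda>k. f (r k) n) \<circ> r') \<longlonglongrightarrow> l'"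
    using bounded_imp_convergent_subsequence[of "\<lambda>k. f (r k) n"] by blast
  have "(\<lambda>k. f ((r \<circ> r') k) i) \<longlonglongrightarrow> (l(n := l')) i" if "i < Suc n" for i
  proof (cases "i = n")
    case True
    then show ?thesis using r' by (simp add: o_def)
  next
    case False
    then show ?thesis
      using that LIMSEQ_subseq_LIMSEQ[OF r(2)[of i] r'(1)] by (simp add: o_def)
  qed
  then show ?case using strict_mono_o[OF r(1) r'(1)] by blast
qed

section \<open>Halfspace descriptions with numbered facets, and their limits\<close>

lemma M_iff: "P \<in> M n \<longleftrightarrow> polytope P \<and> affine hull P = UNIV \<and> card {F. F facet_of P} = n"
  by (auto simp: M_def strictly_convex_polyhedron_def aff_dim_pt_eq_3_iff faces2_def)

lemma full_dim_polytope:
  fixes P :: "'a::euclidean_space set"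
  assumes "polytope P" "affine hull P = UNIV"
  shows "polyhedron P" "bounded P" "closed P" "convex P" "P \<noteq> {}" "interior P \<noteq> {}"
proof -
  show *: "polyhedron P" "bounded P" "closed P" "convex P" "P \<noteq> {}"
    using assms by (auto simp: polytope_imp_polyhedron polytope_imp_bounded polytope_imp_closed polytope_imp_convex)
  show "interior P \<noteq> {}"
    using * assms rel_interior_interior rel_interior_eq_empty by metis
qed

lemma polytope_indexed_halfspaces:
  fixes P :: "'a::euclidean_space set"
  assumes P: "polytope P" "affine hull P = UNIV" and J: "J \<subseteq> {F. F facet_of P}"
  obtains f a b where
    "bij_betw f {..<card {F. F facet_of P}} {F. F facet_of P}" "f ` {..<card J} = J"
    "\<And>i. i < card {F. F facet_of P} \<Longrightarrow> norm (a i) = 1"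
    "\<And>i. i < card {F. F facet_of P} \<Longrightarrow> f i = P \<inter> {x. a i \<bullet> x = b i}"
    "P = {x. \<forall>i < card {F. F facet_of P}. a i \<bullet> x \<le> b i}"
proof -
  let ?X = "{F. F facet_of P}"
  obtain a b where ab: "\<And>F. F facet_of P \<Longrightarrow> norm (a F) = 1"
    "\<And>F. F facet_of P \<Longrightarrow> F = P \<inter> {x. a F \<bullet> x = b F}"
    "P = {x. \<forall>F. F facet_of P \<longrightarrow> a F \<bullet> x \<le> b F}"
    by (rule polyhedron_facet_halfspaces[OF full_dim_polytope(1)[OF P] P(2)]) blast
  obtain f where f: "bij_betw f {..<card ?X} ?X" "f ` {..<card J} = J"
    using bij_betw_extending_enumeration[OF finite_polytope_facets[OF P(1)] J] .
  have fX: "f i facet_of P" if "i < card ?X" for i using bij_betwE[OF f(1)] that by blast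
  have "P = {x. \<forall>F\<in>f ` {..<card ?X}. a F \<bullet> x \<le> b F}"
    unfolding bij_betw_imp_surj_on[OF f(1)] using ab(3) by simp
  then have "P = {x. \<forall>i < card ?X. a (f i) \<bullet> x \<le> b (f i)}"
    by (rule trans) auto
  with that[OF f, of "\<lambda>i. a (f i)" "\<lambda>i. b (f i)"] ab(1,2) fX show thesis by blast
qed

text \<open>By pigeonhole: all \<open>n\<close> facets occur among the \<open>n\<close> sets listed,
  so each of these is a facet and no two coincide.\<close>

lemma indexed_halfspaces_facets:
  fixes P :: "'a::euclidean_space set"
  assumes P: "P = {x. \<forall>i<n. a i \<bullet> x \<le> b i}" and nz: "\<And>i. i < n \<Longrightarrow> a i \<noteq> 0"
    and full: "affine hull P = UNIV" and card: "card {F. F facet_of P} = n"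
  shows "bij_betw (\<lambda>i. P \<inter> {x. a i \<bullet> x = b i}) {..<n} {F. F facet_of P}"
proof -
  let ?G = "\<lambda>i. P \<inter> {x. a i \<bullet> x = b i}"
  have P': "P = {x. \<forall>i\<in>{..<n}. a i \<bullet> x \<le> b i}" using P by auto
  have "{F. F facet_of P} \<subseteq> ?G ` {..<n}"
    using facet_of_halfspaces[OF finite_lessThan P' _ full] nz by blast
  moreover have "card (?G ` {..<n}) \<le> card {..<n}"
    by (rule card_image_le) simp
  ultimately have eq: "{F. F facet_of P} = ?G ` {..<n}"
    using card by (intro card_seteq) auto
  then have "card (?G ` {..<n}) = card {..<n}" using card by simp
  then have "inj_on ?G {..<n}" by (intro eq_card_imp_inj_on) auto
  then show ?thesis using eq by (simp add: bij_betw_def)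
qed

text \<open>Unit normals and offsets of the facets of the approximating polytopes subconverge, and the
  limiting halfspaces cut out \<open>P\<close>. As \<open>P\<close> has as many facets as there are halfspaces, distinct indices
  give distinct facets, so four concurrent facets would survive in the limit.\<close>
lemma simple_polytope_in_convergent_sequence:
  fixes P :: "pt set" and Q :: "nat \<Rightarrow> pt set"
  assumes P: "P \<in> M n" and simple: "simple_polytope P" and Q: "\<And>k. Q k \<in> M n"
    and lim: "(\<lambda>k. hausdorff_dist P (Q k)) \<longlonglongrightarrow> 0"
  shows "\<exists>k. simple_polytope (Q k)"
proof (rule ccontr)
  assume ns: "\<not> ?thesis"
  have PP: "polytope P" "affine hull P = UNIV" "card {F. F facet_of P} = n"
    using P by (auto simp: M_iff)
  have QQ: "polytope (Q k)" "affine hull (Q k) = UNIV" "card {F. F facet_of Q k} = n" for k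
    using Q[of k] by (auto simp: M_iff)
  note P_props = full_dim_polytope[OF PP(1,2)]
  note Q_props = full_dim_polytope[OF QQ(1,2)]
  \<comment> \<open>All choices to be made for \<open>Q k\<close>. The points touching each plane
    keep the offsets bounded; \<open>x\<close> lies on the first four planes.\<close>
  define rep where "rep k a b x \<longleftrightarrow> Q k = {x. \<forall>i<n. a i \<bullet> x \<le> b i} \<and> (\<forall>i<n. norm (a i) = 1) \<and>
      (\<forall>i<n. \<exists>y\<in>Q k. a i \<bullet> y = b i) \<and> 4 \<le> n \<and> x \<in> Q k \<and> (\<forall>i<4. a i \<bullet> x = b i)" for k a b x
  have "\<exists>a b x. rep k a b x" for k
  proof -
    obtain x where "\<not> card {F. F facet_of Q k \<and> x \<in> F} \<le> 3"
      using ns QQ[of k] by (auto simp: simple_polytope_def)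
    then have "4 \<le> card {F. F facet_of Q k \<and> x \<in> F}" by simp
    then obtain J where J: "J \<subseteq> {F. F facet_of Q k \<and> x \<in> F}" "card J = 4"
      by (meson obtain_subset_with_card_n)
    then have J': "J \<subseteq> {F. F facet_of Q k}" by blast
    obtain f a b where f: "bij_betw f {..<n} {F. F facet_of Q k}" "f ` {..<4} = J"
      and a: "\<And>i. i < n \<Longrightarrow> norm (a i) = 1" and fi: "\<And>i. i < n \<Longrightarrow> f i = Q k \<inter> {x. a i \<bullet> x = b i}"
      and Qk: "Q k = {x. \<forall>i < n. a i \<bullet> x \<le> b i}"
      using polytope_indexed_halfspaces[OF QQ(1,2) J'] unfolding QQ(3) J(2) by blast
    have n4: "4 \<le> n"
      using card_mono[OF finite_polytope_facets[OF QQ(1)] J'] J(2) QQ(3) by simp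
    have x: "x \<in> f i" if "i < 4" for i using that f(2) J(1) by blast
    have "\<exists>y\<in>Q k. a i \<bullet> y = b i" if "i < n" for i
    proof -
      have "f i facet_of Q k" using bij_betwE[OF f(1)] that by blast
      then have "f i \<noteq> {}" by (simp add: facet_of_def)
      then show ?thesis using fi[OF that] by blast
    qed
    moreover have "a i \<bullet> x = b i" "x \<in> Q k" if "i < 4" for i
      using x[OF that] fi[of i] n4 that by auto
    moreover from this(2)[of 0] have "x \<in> Q k" by simp
    ultimately show ?thesis unfolding rep_def using Qk a n4 by blast
  qed
  then obtain a b x where rep: "\<And>k. rep k (a k) (b k) (x k)" by metis
  have Qk: "\<And>k. Q k = {x. \<forall>i<n. a k i \<bullet> x \<le> b k i}"
    and a: "\<And>k i. i < n \<Longrightarrow> norm (a k i) = 1"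
    and y: "\<And>k i. i < n \<Longrightarrow> \<exists>y\<in>Q k. a k i \<bullet> y = b k i" and n4: "4 \<le> n"
    and xQ: "\<And>k. x k \<in> Q k" and x: "\<And>k i. i < 4 \<Longrightarrow> a k i \<bullet> x k = b k i"
    using rep unfolding rep_def by blast+
  have near_P: "infdist y P \<le> hausdorff_dist P (Q k)" if "y \<in> Q k" for y k
    using infdist_le_hausdorff_dist(2)[OF P_props(2,5) Q_props(2,5) that] .
  have near_Q: "infdist y (Q k) \<le> hausdorff_dist P (Q k)" if "y \<in> P" for y k
    using infdist_le_hausdorff_dist(1)[OF P_props(2,5) Q_props(2,5) that] .
  obtain D where D: "\<And>k. hausdorff_dist P (Q k) \<le> D"
    using convergent_imp_bounded[OF lim] by (auto simp: bounded_iff) (metis abs_le_D1)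
  obtain R where R: "\<And>p. p \<in> P \<Longrightarrow> norm p \<le> R"
    using P_props(2) by (auto simp: bounded_iff)
  have Q_bound: "norm y \<le> R + D" if yQ: "y \<in> Q k" for y k
  proof -
    obtain p where p: "p \<in> P" "infdist y P = dist y p"
      using infdist_attains_inf[OF P_props(3,5)] by blast
    have "norm y \<le> norm p + dist y p" by (metis dist_norm norm_triangle_sub)
    then show ?thesis using R[OF p(1)] near_P[OF yQ] D[of k] p(2) by simp
  qed
  have b_bound: "\<bar>b k i\<bar> \<le> R + D" if i: "i < n" for k i
  proof -
    obtain y where y: "y \<in> Q k" "a k i \<bullet> y = b k i" using y[OF i] by blast
    then show ?thesis
      using Cauchy_Schwarz_ineq2[of "a k i" y] a[OF i, of k] Q_bound[OF y(1)] by simp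
  qed
  \<comment> \<open>The point \<open>x k\<close> is carried along in every triple, so one extraction
    makes normals, offsets and points converge together; index \<open>0\<close> then provides the
    limit \<open>\<xi>\<close>.\<close>
  have "bounded (range (\<lambda>k. (a k i, b k i, x k)))" if "i < n" for i
  proof -
    have "bounded (range (\<lambda>k. a k i))" "bounded (range (\<lambda>k. b k i))" "bounded (range x)"
      using a[OF that] b_bound[OF that] Q_bound[OF xQ] by (auto simp: bounded_iff)
    then have "bounded (range (\<lambda>k. a k i) \<times> range (\<lambda>k. b k i) \<times> range x)"
      by (intro bounded_Times)
    then show ?thesis by (rule bounded_subset) auto
  qed
  then obtain r l where r: "strict_mono r"
    and l: "\<And>i. i < n \<Longrightarrow> (\<lambda>k. (a (r k) i, b (r k) i, x (r k))) \<longlonglongrightarrow> l i"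
    using convergent_subsequence_finite_family[of n "\<lambda>k i. (a k i, b k i, x k)"] by blast
  define \<alpha> \<beta> \<xi> where "\<alpha> i = fst (l i)" and "\<beta> i = fst (snd (l i))" and "\<xi> = snd (snd (l 0))" for i
  have \<alpha>: "(\<lambda>k. a (r k) i) \<longlonglongrightarrow> \<alpha> i" and \<beta>: "(\<lambda>k. b (r k) i) \<longlonglongrightarrow> \<beta> i" if "i < n" for i
    using tendsto_fst[OF l[OF that]] tendsto_fst[OF tendsto_snd[OF l[OF that]]]
    by (simp_all add: \<alpha>_def \<beta>_def)
  have \<xi>: "(\<lambda>k. x (r k)) \<longlonglongrightarrow> \<xi>"
    using tendsto_snd[OF tendsto_snd[OF l[of 0]]] n4 by (simp add: \<xi>_def)
  have lim': "(\<lambda>k. hausdorff_dist P (Q (r k))) \<longlonglongrightarrow> 0"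
    using LIMSEQ_subseq_LIMSEQ[OF lim r] by (simp add: o_def)
  have \<alpha>1: "norm (\<alpha> i) = 1" if "i < n" for i
    using tendsto_norm[OF \<alpha>[OF that]] a[OF that] by (simp add: LIMSEQ_const_iff)
  have P_sub: "\<alpha> i \<bullet> p \<le> \<beta> i" if p: "p \<in> P" and i: "i < n" for p i
  proof -
    have "\<exists>q. q \<in> Q (r k) \<and> infdist p (Q (r k)) = dist p q" for k
      by (rule infdist_attains_inf[OF Q_props(3,5), of "r k" p]) blast
    then obtain q where q: "\<And>k. q k \<in> Q (r k)" "\<And>k. infdist p (Q (r k)) = dist p (q k)" by metis
    have "dist (q k) p \<le> hausdorff_dist P (Q (r k))" for k
      using near_Q[OF p, of "r k"] q(2)[of k] by (simp add: dist_commute)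
    then have "(\<lambda>k. dist (q k) p) \<longlonglongrightarrow> 0"
      by (intro Lim_null_comparison[OF _ lim']) auto
    then have "q \<longlonglongrightarrow> p" by (rule tendsto_dist_iff[THEN iffD2])
    then have "(\<lambda>k. a (r k) i \<bullet> q k) \<longlonglongrightarrow> \<alpha> i \<bullet> p"
      by (rule tendsto_inner[OF \<alpha>[OF i]])
    then show ?thesis
      by (rule LIMSEQ_le[OF _ \<beta>[OF i]]) (use q(1) i in \<open>auto simp: Qk\<close>)
  qed
  obtain p where p: "p \<in> interior P" using P_props(6) by blast
  have strict: "\<alpha> i \<bullet> p < \<beta> i" if i: "i < n" for i
  proof -
    obtain e where e: "e > 0" "cball p e \<subseteq> P" using p by (auto simp: mem_interior_cball)
    have "p + e *\<^sub>R \<alpha> i \<in> cball p e" using e \<alpha>1[OF i] by (simp add: dist_norm)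
    then have "\<alpha> i \<bullet> (p + e *\<^sub>R \<alpha> i) \<le> \<beta> i" using P_sub[OF _ i] e by blast
    then show ?thesis
      using e \<alpha>1[OF i] by (simp add: inner_simps dot_square_norm)
  qed
  \<comment> \<open>If \<open>z\<close> is tight for a limiting halfspace, it may lie outside every
    \<open>Q k\<close>. Pulled towards the interior point \<open>p\<close>, it satisfies all
    limiting inequalities strictly, hence those of \<open>Q (r k)\<close> for large
    \<open>k\<close>; closedness of \<open>P\<close> then gives back \<open>z\<close>.\<close>
  have P_sup: "z \<in> P" if z: "\<And>i. i < n \<Longrightarrow> \<alpha> i \<bullet> z \<le> \<beta> i" for z
  proof -
    have seg: "p + t *\<^sub>R (z - p) \<in> P" if t: "0 \<le> t" "t < 1" for t
    proof -
      let ?y = "p + t *\<^sub>R (z - p)"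
      have "\<forall>\<^sub>F k in sequentially. a (r k) i \<bullet> ?y < b (r k) i" if i: "i < n" for i
      proof -
        have "(1 - t) * (\<alpha> i \<bullet> p) < (1 - t) * \<beta> i" using strict[OF i] t by simp
        moreover have "t * (\<alpha> i \<bullet> z) \<le> t * \<beta> i" using z[OF i] t by (simp add: mult_left_mono)
        ultimately have "0 < \<beta> i - \<alpha> i \<bullet> ?y" by (simp add: inner_simps algebra_simps)
        moreover have "(\<lambda>k. b (r k) i - a (r k) i \<bullet> ?y) \<longlonglongrightarrow> \<beta> i - \<alpha> i \<bullet> ?y"
          by (intro tendsto_diff tendsto_inner tendsto_const \<alpha>[OF i] \<beta>[OF i])
        ultimately have "\<forall>\<^sub>F k in sequentially. 0 < b (r k) i - a (r k) i \<bullet> ?y"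
          by (rule order_tendstoD(1)[rotated])
        then show ?thesis by eventually_elim simp
      qed
      then have "\<forall>\<^sub>F k in sequentially. \<forall>i\<in>{..<n}. a (r k) i \<bullet> ?y < b (r k) i"
        by (intro eventually_ball_finite) auto
      then have "\<forall>\<^sub>F k in sequentially. infdist ?y P \<le> hausdorff_dist P (Q (r k))"
      proof eventually_elim
        case (elim k)
        then have "?y \<in> Q (r k)" by (auto simp: Qk less_imp_le)
        then show ?case by (rule near_P)
      qed
      then have "infdist ?y P \<le> 0"
        by (rule tendsto_lowerbound[OF lim']) simp
      then show ?thesis
        using in_closed_iff_infdist_zero[OF P_props(3,5)] infdist_nonneg[of ?y P] by simp
    qed
    have to_z: "(\<lambda>m. p + (1 - inverse (real (Suc m))) *\<^sub>R (z - p)) \<longlonglongrightarrow> p + (1 - 0) *\<^sub>R (z - p)"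
      by (intro tendsto_intros LIMSEQ_inverse_real_of_nat)
    have "p + (1 - inverse (real (Suc m))) *\<^sub>R (z - p) \<in> P" for m
      by (intro seg) (auto simp: field_simps)
    then have "p + (1 - 0) *\<^sub>R (z - p) \<in> P"
      by (rule closed_sequentially[OF P_props(3) _ to_z])
    then show ?thesis by simp
  qed
  have P_eq: "P = {z. \<forall>i<n. \<alpha> i \<bullet> z \<le> \<beta> i}" using P_sub P_sup by blast
  have bij: "bij_betw (\<lambda>i. P \<inter> {z. \<alpha> i \<bullet> z = \<beta> i}) {..<n} {F. F facet_of P}"
    using \<alpha>1 by (intro indexed_halfspaces_facets[OF P_eq _ PP(2,3)]) force
  have "\<alpha> i \<bullet> \<xi> \<le> \<beta> i" if "i < n" for i
    by (rule LIMSEQ_le[OF tendsto_inner[OF \<alpha>[OF that] \<xi>] \<beta>[OF that]])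
       (use xQ that in \<open>auto simp: Qk\<close>)
  then have \<xi>P: "\<xi> \<in> P" by (simp add: P_eq)
  have \<xi>4: "\<alpha> i \<bullet> \<xi> = \<beta> i" if "i < 4" for i
  proof -
    have i: "i < n" using that n4 by simp
    show ?thesis
      by (rule LIMSEQ_unique[OF tendsto_inner[OF \<alpha>[OF i] \<xi>]]) (use \<beta>[OF i] x[OF that] in simp)
  qed
  have "(\<lambda>i. P \<inter> {z. \<alpha> i \<bullet> z = \<beta> i}) ` {..<4} \<subseteq> {F. F facet_of P \<and> \<xi> \<in> F}"
    using bij_betwE[OF bij] n4 \<xi>P \<xi>4 by auto
  then have "card ((\<lambda>i. P \<inter> {z. \<alpha> i \<bullet> z = \<beta> i}) ` {..<4}) \<le> card {F. F facet_of P \<and> \<xi> \<in> F}"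
    using finite_polytope_facets[OF PP(1)] by (intro card_mono) auto
  moreover have "inj_on (\<lambda>i. P \<inter> {z. \<alpha> i \<bullet> z = \<beta> i}) {..<4}"
    by (rule inj_on_subset[OF bij_betw_imp_inj_on[OF bij]]) (use n4 in auto)
  ultimately have "4 \<le> card {F. F facet_of P \<and> \<xi> \<in> F}" by (simp add: card_image)
  moreover have "card {F. F facet_of P \<and> \<xi> \<in> F} \<le> 3" using simple by (simp add: simple_polytope_def)
  ultimately show False by simp
qed

lemma open_simple_polytopes: "open_in_M (M n) {P \<in> M n. simple_polytope P}"
  unfolding open_in_M_def
proof (intro conjI ballI)
  fix P assume P: "P \<in> {P \<in> M n. simple_polytope P}"
  show "\<exists>\<epsilon>>0. \<forall>Q\<in>M n. hausdorff_dist P Q < \<epsilon> \<longrightarrow> Q \<in> {P \<in> M n. simple_polytope P}"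
  proof (rule ccontr)
    assume neg: "\<not> ?thesis"
    have "\<exists>Q. Q \<in> M n \<and> hausdorff_dist P Q < inverse (real (Suc k)) \<and> \<not> simple_polytope Q" for k
      using neg[simplified] by (meson inverse_positive_iff_positive of_nat_0_less_iff zero_less_Suc)
    then obtain Q where Q: "\<And>k. Q k \<in> M n" "\<And>k. hausdorff_dist P (Q k) < inverse (real (Suc k))"
      "\<And>k. \<not> simple_polytope (Q k)" by metis
    have "P \<in> M n" using P by simp
    then have "P \<noteq> {}" "bounded P" "Q k \<noteq> {}" "bounded (Q k)" for k
      using full_dim_polytope Q(1)[of k] by (auto simp: M_iff)
    then have "0 \<le> hausdorff_dist P (Q k)" for k
      using infdist_le_hausdorff_dist(1)[of P "Q k"] infdist_nonneg order_trans by blast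
    then have "(\<lambda>k. hausdorff_dist P (Q k)) \<longlonglongrightarrow> 0"
      using Q(2) by (intro Lim_null_comparison[OF _ LIMSEQ_inverse_real_of_nat]) (auto simp: less_imp_le)
    then show False
      using simple_polytope_in_convergent_sequence[of P n Q] P Q by auto
  qed
qed auto

section \<open>Density\<close>

lemma family_dependent:
  fixes a :: "'i \<Rightarrow> 'a::euclidean_space"
  assumes J: "finite J" "DIM('a) < card J"
  obtains u k where "k \<in> J" "u k \<noteq> (0::real)" "(\<Sum>i\<in>J. u i *\<^sub>R a i) = 0"
proof (cases "inj_on a J")
  case True
  then have "dependent (a ` J)"
    using J by (intro dependent_biggerset) (simp add: card_image)
  then obtain u v where u: "v \<in> a ` J" "u v \<noteq> 0" "(\<Sum>v\<in>a ` J. u v *\<^sub>R v) = 0"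
    using J(1) dependent_finite[of "a ` J"] by auto
  obtain k where "k \<in> J" "v = a k" using u(1) by blast
  then show thesis
    using that[of k "\<lambda>i. u (a i)"] u True by (simp add: sum.reindex)
next
  case False
  then obtain i j where ij: "i \<in> J" "j \<in> J" "i \<noteq> j" "a i = a j" by (auto simp: inj_on_def)
  define u where "u k = (if k = i then 1 else if k = j then - 1 else 0 :: real)" for k
  have "(\<Sum>k\<in>J. u k *\<^sub>R a k) = (\<Sum>k\<in>{i, j}. u k *\<^sub>R a k)"
    using J ij by (intro sum.mono_neutral_right) (auto simp: u_def)
  also have "\<dots> = 0" using ij by (simp add: u_def)
  finally show thesis using that[of i u] ij by (simp add: u_def)
qed

text \<open>A linear dependency between the normals turns concurrency of the shifted hyperplanes into a
  nonzero polynomial equation for \<open>s\<close>; the exponents are distinct and positive so that no terms cancel.\<close>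
lemma finite_concurrent_perturbations:
  fixes a :: "nat \<Rightarrow> 'a::euclidean_space" and b :: "nat \<Rightarrow> real"
  assumes J: "finite J" "DIM('a) < card J"
  shows "finite {s. \<exists>x. \<forall>i\<in>J. a i \<bullet> x = b i + s ^ Suc i}"
proof -
  obtain u k where u: "k \<in> J" "u k \<noteq> (0::real)" "(\<Sum>i\<in>J. u i *\<^sub>R a i) = 0"
    by (rule family_dependent[OF J])
  obtain N where N: "J \<subseteq> {..<N}" using J(1) finite_nat_iff_bounded by blast
  \<comment> \<open>The offsets contribute the constant term, and shift \<open>i\<close> the
    coefficient in degree \<open>i + 1\<close>, so \<open>u k \<noteq> 0\<close> survives as a
    coefficient.\<close>
  define c where "c m = (case m of 0 \<Rightarrow> \<Sum>i\<in>J. u i * b i | Suc i \<Rightarrow> if i \<in> J then u i else 0)" for m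
  have "(\<Sum>m\<le>N. c m * s ^ m) = 0" if s: "\<forall>i\<in>J. a i \<bullet> x = b i + s ^ Suc i" for s x
  proof -
    have "(\<Sum>m\<le>N. c m * s ^ m) = (\<Sum>i\<in>J. u i * b i) + (\<Sum>i<N. (if i \<in> J then u i * s ^ Suc i else 0))"
      unfolding sum.atMost_shift by (auto simp: c_def intro!: sum.cong)
    also have "(\<Sum>i<N. (if i \<in> J then u i * s ^ Suc i else 0)) = (\<Sum>i\<in>J. u i * s ^ Suc i)"
      using N by (simp add: sum.inter_restrict[symmetric] Int_absorb1)
    also have "(\<Sum>i\<in>J. u i * b i) + (\<Sum>i\<in>J. u i * s ^ Suc i) = (\<Sum>i\<in>J. u i * (a i \<bullet> x))"
      using s by (simp add: sum.distrib[symmetric] distrib_left)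
    also have "\<dots> = (\<Sum>i\<in>J. u i *\<^sub>R a i) \<bullet> x" by (simp add: inner_sum_left)
    finally show ?thesis using u(3) by simp
  qed
  then have "{s. \<exists>x. \<forall>i\<in>J. a i \<bullet> x = b i + s ^ Suc i} \<subseteq> {s. (\<Sum>m\<le>N. c m * s ^ m) = 0}" by blast
  moreover have "\<exists>m\<le>N. c m \<noteq> 0" using u N by (intro exI[of _ "Suc k"]) (auto simp: c_def)
  then have "finite {s. (\<Sum>m\<le>N. c m * s ^ m) = 0}" using polyfun_finite_roots[of c N] by blast
  ultimately show ?thesis by (rule finite_subset)
qed

text \<open>Take a relative interior point of \<open>F\<close>: a facet through it contains all of
  \<open>F\<close> and has the same dimension.\<close>

lemma facet_private_point:
  fixes P :: "'a::euclidean_space set"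
  assumes F: "F facet_of P"
  obtains x where "x \<in> F" "\<And>G. G facet_of P \<Longrightarrow> x \<in> G \<Longrightarrow> G = F"
proof -
  have Fface: "F face_of P" and "F \<noteq> {}" using F by (auto simp: facet_of_def)
  then obtain x where x: "x \<in> rel_interior F"
    using face_of_imp_convex rel_interior_eq_empty by blast
  have "G = F" if G: "G facet_of P" "x \<in> G" for G
  proof (rule ccontr)
    assume "G \<noteq> F"
    have Gface: "G face_of P" using G facet_of_imp_face_of by blast
    have "F \<subseteq> G"
      using subset_of_face_of[OF Gface face_of_imp_subset[OF Fface]] x G by blast
    then have "F face_of G"
      by (rule face_of_subset[OF Fface _ face_of_imp_subset[OF Gface]])
    then have "aff_dim F < aff_dim G"
      using face_of_aff_dim_lt face_of_imp_convex[OF Gface] \<open>G \<noteq> F\<close> by blast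
    then show False using F G by (simp add: facet_of_def)
  qed
  then show thesis using that x rel_interior_subset by blast
qed

text \<open>Shrink \<open>x\<close> towards \<open>p\<close> by the factor
  \<open>1 / (1 + h)\<close>: the slack \<open>d\<close> at \<open>p\<close>, weighted by
  \<open>h\<close>, absorbs the excess \<open>d * h\<close> at \<open>x\<close>. This bounds how far
  the enlarged polyhedron reaches beyond \<open>P\<close>.\<close>

lemma scaled_point_in_halfspaces:
  fixes P :: "'a::euclidean_space set"
  assumes P: "P = {x. \<forall>i<n. a i \<bullet> x \<le> b i}"
    and p: "\<And>i. i < n \<Longrightarrow> a i \<bullet> p + d \<le> b i" and "d > 0" "h > 0"
    and x: "\<And>i. i < n \<Longrightarrow> a i \<bullet> x \<le> b i + d * h"
  obtains y where "y \<in> P" "x - y = h *\<^sub>R (y - p)"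
proof -
  define y where "y = p + (1 / (1 + h)) *\<^sub>R (x - p)"
  have eq: "(1 + h) *\<^sub>R (y - p) = x - p" using \<open>h > 0\<close> by (simp add: y_def)
  have "a i \<bullet> y \<le> b i" if "i < n" for i
  proof -
    have "(1 + h) * (a i \<bullet> (y - p)) = a i \<bullet> (x - p)"
      using arg_cong[OF eq, of "inner (a i)"] by simp
    also have "\<dots> \<le> b i + d * h - a i \<bullet> p" using x[OF that] by (simp add: inner_simps)
    also have "\<dots> \<le> (1 + h) * (b i - a i \<bullet> p)"
      using mult_left_mono[OF p[OF that], of h] \<open>h > 0\<close> by (simp add: algebra_simps)
    finally have "a i \<bullet> (y - p) \<le> b i - a i \<bullet> p" using \<open>h > 0\<close> by simp
    then show ?thesis by (simp add: inner_simps)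
  qed
  then have "y \<in> P" by (simp add: P)
  moreover have "x - y = h *\<^sub>R (y - p)" using eq by (simp add: algebra_simps)
  ultimately show thesis by (rule that)
qed

lemma dense_simple_polytopes: "dense_in_M (M n) {P \<in> M n. simple_polytope P}"
  unfolding dense_in_M_def
proof (intro ballI allI impI)
  fix P and \<epsilon> :: real assume PM: "P \<in> M n" and "\<epsilon> > 0"
  have PP: "polytope P" "affine hull P = UNIV" "card {F. F facet_of P} = n"
    using PM by (auto simp: M_iff)
  note P_props = full_dim_polytope[OF PP(1,2)]
  obtain f a b where f: "bij_betw f {..<n} {F. F facet_of P}"
    and a: "\<And>i. i < n \<Longrightarrow> norm (a i) = 1" and fi: "\<And>i. i < n \<Longrightarrow> f i = P \<inter> {x. a i \<bullet> x = b i}"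
    and P: "P = {x. \<forall>i < n. a i \<bullet> x \<le> b i}"
    by (rule polytope_indexed_halfspaces[OF PP(1,2) empty_subsetI, unfolded PP(3)]) blast
  have f_facet: "f i facet_of P" if "i < n" for i using bij_betwE[OF f] that by blast
  \<comment> \<open>These points witness that no facet is lost: displaced by the shift of plane
    \<open>i\<close> along its unit normal, such a point lands on the new plane and, for small
    \<open>s\<close>, stays strictly inside the others.\<close>
  have "\<exists>x. a i \<bullet> x = b i \<and> (\<forall>j<n. j \<noteq> i \<longrightarrow> a j \<bullet> x < b j)" if i: "i < n" for i
  proof -
    obtain x where x: "x \<in> f i" "\<And>G. G facet_of P \<Longrightarrow> x \<in> G \<Longrightarrow> G = f i"
      using facet_private_point[OF f_facet[OF i]] by blast
    have xP: "x \<in> P" using x(1) fi[OF i] by blast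
    have "a j \<bullet> x < b j" if j: "j < n" "j \<noteq> i" for j
    proof -
      have "f j \<noteq> f i" using bij_betw_imp_inj_on[OF f] i j by (auto simp: inj_on_def)
      then have "x \<notin> f j" using x(2)[OF f_facet[OF j(1)]] by blast
      then have "a j \<bullet> x \<noteq> b j" using fi[OF j(1)] xP by blast
      moreover have "a j \<bullet> x \<le> b j" using xP P j(1) by blast
      ultimately show ?thesis by simp
    qed
    then show ?thesis using x(1) fi[OF i] by blast
  qed
  then obtain X where X: "\<And>i. i < n \<Longrightarrow> a i \<bullet> X i = b i"
    "\<And>i j. i < n \<Longrightarrow> j < n \<Longrightarrow> j \<noteq> i \<Longrightarrow> a j \<bullet> X i < b j" by metis
  obtain p where p: "p \<in> interior P" using P_props(6) by blast
  obtain d where d: "d > 0" "cball p d \<subseteq> P" using p by (auto simp: mem_interior_cball)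
  have pd: "a i \<bullet> p + d \<le> b i" if i: "i < n" for i
  proof -
    have "p + d *\<^sub>R a i \<in> cball p d" using d a[OF i] by (simp add: dist_norm)
    then have "a i \<bullet> (p + d *\<^sub>R a i) \<le> b i" using d P i by blast
    then show ?thesis using a[OF i] by (simp add: inner_simps dot_square_norm)
  qed
  obtain R\<^sub>0 where R\<^sub>0: "\<And>y. y \<in> P \<Longrightarrow> dist p y \<le> R\<^sub>0"
    using P_props(2) unfolding bounded_any_center[of P p] by blast
  define R where "R = max R\<^sub>0 1"
  have R: "R > 0" "\<And>y. y \<in> P \<Longrightarrow> dist p y \<le> R"
    using R\<^sub>0 by (simp_all add: R_def le_max_iff_disj)
  \<comment> \<open>With this \<open>h\<close>, shifts of at most \<open>d * h\<close> keep every
    point of \<open>Q\<close> within \<open>h * R\<close>, half of \<open>\<epsilon>\<close>, of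
    \<open>P\<close>. The maximum with 1 made \<open>R\<close> safe to divide by.\<close>
  define h where "h = \<epsilon> / (2 * R)"
  have h: "h > 0" "h * R < \<epsilon>" using R(1) \<open>\<epsilon> > 0\<close> by (auto simp: h_def)
  \<comment> \<open>The bad parameters: some four shifted planes, one more than the dimension, have
    a common point.\<close>
  define Z where "Z = (\<Union>J\<in>{J. J \<subseteq> {..<n} \<and> card J = 4}. {s. \<exists>x::pt. \<forall>i\<in>J. a i \<bullet> x = b i + s ^ Suc i})"
  have "finite Z"
    unfolding Z_def
  proof (intro finite_UN_I)
    show "finite {J. J \<subseteq> {..<n} \<and> card J = 4}"
      by (rule finite_subset[of _ "Pow {..<n}"]) auto
    show "finite {s. \<exists>x::pt. \<forall>i\<in>J. a i \<bullet> x = b i + s ^ Suc i}" if "J \<in> {J. J \<subseteq> {..<n} \<and> card J = 4}" for J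
      using that finite_subset[of J "{..<n}"] by (intro finite_concurrent_perturbations) auto
  qed
  then have "\<forall>\<^sub>F s in at_right 0. \<forall>z\<in>Z. s \<noteq> z"
    by (intro eventually_ball_finite) (auto simp: eventually_neq_at_within)
  moreover have "\<forall>\<^sub>F s::real in at_right 0. s > 0" by (rule eventually_at_right_less)
  moreover have "\<forall>\<^sub>F s::real in at_right 0. s < min 1 (d * h)"
    using d h by (intro order_tendstoD(2)[OF tendsto_ident_at]) auto
  moreover have "\<forall>\<^sub>F s in at_right 0. \<forall>i\<in>{..<n}. \<forall>j\<in>{..<n}. j \<noteq> i \<longrightarrow> a j \<bullet> (X i + s ^ Suc i *\<^sub>R a i) < b j"
  proof (intro eventually_ball_finite ballI finite_lessThan)
    fix i j assume ij: "i \<in> {..<n}" "j \<in> {..<n}"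
    have "((\<lambda>s. a j \<bullet> (X i + s ^ Suc i *\<^sub>R a i)) \<longlongrightarrow> a j \<bullet> (X i + 0 ^ Suc i *\<^sub>R a i)) (at_right 0)"
      by (intro tendsto_intros)
    moreover have "a j \<bullet> (X i + 0 ^ Suc i *\<^sub>R a i) < b j" if "j \<noteq> i" using X(2) ij that by simp
    ultimately show "\<forall>\<^sub>F s in at_right 0. j \<noteq> i \<longrightarrow> a j \<bullet> (X i + s ^ Suc i *\<^sub>R a i) < b j"
      by (cases "j = i") (simp_all add: order_tendstoD(2))
  qed
  ultimately have "\<forall>\<^sub>F s in at_right 0. s \<notin> Z \<and> s > 0 \<and> s < min 1 (d * h) \<and>
      (\<forall>i\<in>{..<n}. \<forall>j\<in>{..<n}. j \<noteq> i \<longrightarrow> a j \<bullet> (X i + s ^ Suc i *\<^sub>R a i) < b j)"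
    by eventually_elim auto
  from eventually_happens'[OF trivial_limit_at_right_real this]
  obtain s where s: "s \<notin> Z" "s > 0" "s < 1" "s < d * h"
    and sX: "\<And>i j. i < n \<Longrightarrow> j < n \<Longrightarrow> j \<noteq> i \<Longrightarrow> a j \<bullet> (X i + s ^ Suc i *\<^sub>R a i) < b j"
    by auto
  define b' where "b' i = b i + s ^ Suc i" for i
  define Q where "Q = {x. \<forall>i<n. a i \<bullet> x \<le> b' i}"
  have b': "b i < b' i" "b' i \<le> b i + d * h" for i
  proof -
    show "b i < b' i" using s by (simp add: b'_def)
    \<comment> \<open>Because \<open>s < 1\<close>, the single bound \<open>s < d * h\<close>
      controls all shifts.\<close>
    have "s ^ Suc i \<le> s" using power_le_one[of s i] mult_left_le[of "s ^ i" s] s by simp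
    then show "b' i \<le> b i + d * h" using s(4) unfolding b'_def by linarith
  qed
  have PQ: "P \<subseteq> Q"
  proof
    fix x assume "x \<in> P"
    then have "a i \<bullet> x \<le> b i" if "i < n" for i using P that by blast
    then have "a i \<bullet> x \<le> b' i" if "i < n" for i
      using order_trans[OF _ less_imp_le[OF b'(1)]] that by blast
    then show "x \<in> Q" unfolding Q_def by blast
  qed
  have near: "\<exists>y\<in>P. dist x y \<le> h * R" if "x \<in> Q" for x
  proof -
    have "a i \<bullet> x \<le> b' i" if "i < n" for i using \<open>x \<in> Q\<close> that unfolding Q_def by blast
    then have x_le: "a i \<bullet> x \<le> b i + d * h" if "i < n" for i
      using order_trans[OF _ b'(2)] that by blast
    obtain y where y: "y \<in> P" "x - y = h *\<^sub>R (y - p)"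
      by (rule scaled_point_in_halfspaces[OF P pd d(1) h(1) x_le])
    have "dist x y = h * dist p y" using y(2) h(1) by (simp add: dist_norm norm_minus_commute)
    then show ?thesis using y(1) R(2)[OF y(1)] h(1) by (intro bexI[of _ y]) simp_all
  qed
  have "bounded Q"
  proof -
    have "dist p x \<le> R + h * R" if x: "x \<in> Q" for x
    proof -
      obtain y where y: "y \<in> P" "dist x y \<le> h * R" using near[OF x] by blast
      then show ?thesis
        using dist_triangle[of p x y] R(2)[OF y(1)] by (simp add: dist_commute)
    qed
    then show ?thesis unfolding bounded_any_center[of Q p] by blast
  qed
  moreover have "polyhedron Q"
  proof -
    have "Q = \<Inter> ((\<lambda>i. {x. a i \<bullet> x \<le> b' i}) ` {..<n})" by (auto simp: Q_def)
    then show ?thesis by (auto intro!: polyhedron_Inter polyhedron_halfspace_le)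
  qed
  ultimately have Qpoly: "polytope Q" by (simp add: polytope_eq_bounded_polyhedron)
  have Qfull: "affine hull Q = UNIV" using hull_mono[OF PQ, of affine] PP(2) by auto
  have nz: "a i \<noteq> 0" if "i < n" for i using a[OF that] by auto
  define G where "G i = Q \<inter> {x. a i \<bullet> x = b' i}" for i
  have Q': "Q = {x. \<forall>i\<in>{..<n}. a i \<bullet> x \<le> b' i}" by (auto simp: Q_def)
  have facet_G: "\<exists>i<n. F = G i" if "F facet_of Q" for F
    using facet_of_halfspaces[OF finite_lessThan Q' _ Qfull that] nz by (auto simp: G_def)
  \<comment> \<open>These displaced points tell the sets \<open>G i\<close> apart, which gives both
    that each is a facet and that no two coincide.\<close>
  have XG: "X i + s ^ Suc i *\<^sub>R a i \<in> G j \<longleftrightarrow> j = i" if i: "i < n" and j: "j < n" for i j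
  proof -
    have eq: "a i \<bullet> (X i + s ^ Suc i *\<^sub>R a i) = b' i"
      using X(1)[OF i] a[OF i] by (simp add: inner_simps dot_square_norm b'_def)
    have lt: "a k \<bullet> (X i + s ^ Suc i *\<^sub>R a i) < b' k" if "k < n" "k \<noteq> i" for k
      using sX[OF i that] b'(1)[of k] by simp
    have "a k \<bullet> (X i + s ^ Suc i *\<^sub>R a i) \<le> b' k" if "k < n" for k
      using eq lt[OF that] by (cases "k = i") auto
    then have "X i + s ^ Suc i *\<^sub>R a i \<in> Q" by (simp add: Q_def)
    then show ?thesis using eq lt[OF j] by (cases "j = i") (auto simp: G_def)
  qed
  have G_facet: "G i facet_of Q" if i: "i < n" for i
  proof -
    have face: "G i face_of Q"
      unfolding G_def using full_dim_polytope(4)[OF Qpoly Qfull] i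
      by (intro face_of_Int_supporting_hyperplane_le) (auto simp: Q_def)
    have ne: "G i \<noteq> {}" using XG[OF i i] by blast
    have "p \<notin> G i" using pd[OF i] d(1) b'(1)[of i] by (auto simp: G_def)
    moreover have "p \<in> Q" using p interior_subset PQ by blast
    ultimately have "G i \<noteq> Q" by blast
    \<comment> \<open>A nonempty proper face lies in some facet, which is some \<open>G j\<close>;
      the point private to \<open>G i\<close> forces \<open>j = i\<close>.\<close>
    then obtain F where F: "F facet_of Q" "G i \<subseteq> F"
      using face_of_polyhedron_subset_facet[OF full_dim_polytope(1)[OF Qpoly Qfull] face ne] by blast
    then obtain j where j: "j < n" "F = G j" using facet_G by blast
    then have "j = i" using XG[OF i j(1)] XG[OF i i] F by blast
    then show ?thesis using F j by simp
  qed
  have facets: "{F. F facet_of Q} = G ` {..<n}" using facet_G G_facet by auto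
  have "inj_on G {..<n}"
  proof (rule inj_onI)
    fix i j assume "i \<in> {..<n}" "j \<in> {..<n}" "G i = G j"
    then show "i = j" using XG[of i i] XG[of i j] by auto
  qed
  then have "card {F. F facet_of Q} = n" by (simp add: facets card_image)
  then have QM: "Q \<in> M n" using Qpoly Qfull by (simp add: M_iff)
  have "card {F. F facet_of Q \<and> x \<in> F} \<le> 3" for x
  proof (rule ccontr)
    define I where "I = {i. i < n \<and> a i \<bullet> x = b' i}"
    assume "\<not> ?thesis"
    moreover have "{F. F facet_of Q \<and> x \<in> F} \<subseteq> G ` I"
      using facets by (auto simp: G_def I_def)
    then have "card {F. F facet_of Q \<and> x \<in> F} \<le> card I"
      by (intro surj_card_le) (simp_all add: I_def)
    ultimately have "4 \<le> card I" by simp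
    then obtain J where "J \<subseteq> I" "card J = 4" by (meson obtain_subset_with_card_n)
    then have "s \<in> Z"
      unfolding Z_def by (intro UN_I[of J]) (auto simp: I_def b'_def)
    then show False using s by blast
  qed
  then have "simple_polytope Q" using Qpoly Qfull by (simp add: simple_polytope_def)
  moreover have "hausdorff_dist P Q \<le> h * R"
  proof (rule hausdorff_dist_le)
    show "infdist x Q \<le> h * R" if "x \<in> P" for x
      using that PQ h(1) R(1) by (simp add: subset_iff)
    show "infdist y P \<le> h * R" if "y \<in> Q" for y
      using near[OF that] infdist_le2 by blast
  qed (use P_props(5) PQ in auto)
  ultimately show "\<exists>Q\<in>{P \<in> M n. simple_polytope P}. hausdorff_dist P Q < \<epsilon>"
    using QM h(2) by (intro bexI[of _ Q]) auto
qed

theorem theorem6: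
  fixes n :: nat
  assumes "n \<ge> 4"
  shows "\<exists>\<Omega>. open_in_M (M n) \<Omega> \<and> dense_in_M (M n) \<Omega> \<and>
           (\<forall>P\<in>\<Omega>. \<forall>P'\<in>\<Omega>.
              faces_affine_equivalent P P' \<longleftrightarrow> affine_equivalent P P')"
proof (intro exI[of _ "{P \<in> M n. simple_polytope P}"] conjI ballI)
  fix P P' assume "P \<in> {P \<in> M n. simple_polytope P}" "P' \<in> {P \<in> M n. simple_polytope P}"
  then show "faces_affine_equivalent P P' \<longleftrightarrow> affine_equivalent P P'"
    using faces_affine_equivalent_imp_affine_equivalent[of P P']
      affine_equivalent_imp_faces_affine_equivalent[of P P']
    by (auto simp: M_def)
qed (rule open_simple_polytopes dense_simple_polytopes)+

end
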